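(* Let $X,Y$ be semi-rectifiable compact plane sets, let $\mathcal{F}$ be an effective collection of paths in $X$, and let $\mathcal{G}$ be an effective collection of paths in $Y$. Let $n\in\mathbb{N}$, and let $\varphi\in D_{\mathcal{F}}^{(n)}(X)$ with $\varphi(X)\subseteq Y$. Suppose that $\varphi$ is $\mathcal{F}$-$\mathcal{G}$-compatible. Then, for all $f\in D_{\mathcal{G}}^{(n)}(Y)$, $f\circ\varphi\in D_{\mathcal{F}}^{(n)}(X)$ and, for each $k\in\{1,2,\dots,n\}$, we have \[ (f\circ\varphi)^{[k]}=\sum_{i=0}^k(f^{[i]}\circ\varphi)\sum\frac{k!}{a_1!\cdots a_k!}\prod_{j=1}^k\left(\frac{\varphi^{[j]}}{j!}\right)^{a_j}, \] where the inner sum is over all $a_1,\dots,a_k\in\mathbb{N}_0$ such that $a_1+\dots+a_k=i$ and $a_1+2a_2+\dots+ka_k=k$.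
   Context: $\mathbb{N}$ is the set of positive integers and $\mathbb{N}_0$ the set of non-negative integers. A compact plane set is a non-empty compact subset of $\mathbb{C}$. $C(X)$ is the algebra of continuous complex-valued functions on $X$. Paths: A path is a continuous map $\gamma:[a,b]\to\mathbb{C}$ with $a<b$ real; $\gamma^-=\gamma(a)$, $\gamma^+=\gamma(b)$, and $\gamma^*=\gamma([a,b])$; $\gamma$ is a path in $X$ if $\gamma^*\subseteq X$. A subpath of $\gamma$ is a restriction of $\gamma$ to a non-degenerate closed subinterval of $[a,b]$. $\gamma$ is rectifiable if its total variation is finite, and then its length $\Lambda(\gamma)$ is $V_a^b(\gamma)$, where $V_c^d(\gamma)$ is the total variation of $\gamma$ over $[c,d]$. $\gamma$ is a Jordan path if it is injective. $\gamma$ is admissible if it is rectifiable and has no constant subpaths. For a non-constant rectifiable path $\gamma$, the path length parametrisation $\gamma^{\mathrm{pl}}:[0,\Lambda(\gamma)]\to\mathbb{C}$ is the unique path with $\gamma^{\mathrm{pl}}(V_a^t(\gamma))=\gamma(t)$ for all $t\in[a,b]$. Integrals $\int_\gamma f(z)\,dz$ along rectifiable paths are Riemann–Stieltjes integrals. A compact plane set $X$ is semi-rectifiable if the union of the images of all rectifiable Jordan paths in $X$ is dense in $X$. A collection $\mathcal{F}$ of paths in $X$ is effective if $\bigcup_{\gamma\in\mathcal{F}}\gamma^*$ is dense in $X$, each path in $\mathcal{F}$ is admissible, and every subpath of a path in $\mathcal{F}$ belongs to $\mathcal{F}$. $\mathcal{F}$-derivatives: For $f\in C(X)$, a function $g\in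 C(X)$ is an $\mathcal{F}$-derivative of $f$ if $\int_\gamma g(z)\,dz=f(\gamma^+)-f(\gamma^-)$ for each $\gamma\in\mathcal{F}$; $f$ is $\mathcal{F}$-differentiable if it has an $\mathcal{F}$-derivative. When $X$ is semi-rectifiable and $\mathcal{F}$ is effective, the $\mathcal{F}$-derivative is unique and is denoted $f^{[1]}$; $D_{\mathcal{F}}^{(1)}(X)$ is the set of all $\mathcal{F}$-differentiable functions in $C(X)$. Inductively, for $n\geq 2$, $D_{\mathcal{F}}^{(n)}(X)=\{f\in D_{\mathcal{F}}^{(1)}(X): f^{[1]}\in D_{\mathcal{F}}^{(n-1)}(X)\}$, $f^{[n]}$ denotes the $n$th $\mathcal{F}$-derivative of $f$, and $f^{[0]}=f$. (Similarly for $\mathcal{G}$ and $Y$.) Compatibility: For an admissible path $\gamma$ in $Y$ and $f,g\in C(Y)$, $g$ is the $\gamma$-derivative of $f$ if $\int_\sigma g(z)\,dz=f(\sigma^+)-f(\sigma^-)$ for each subpath $\sigma$ of $\gamma$. $\mathfrak{m}(\mathcal{G})$ is the collection of all admissible paths $\gamma$ in $Y$ such that, for every $f\in D_{\mathcal{G}}^{(1)}(Y)$, $f^{[1]}$ is the $\gamma$-derivative of $f$. A function $\varphi\in D_{\mathcal{F}}^{(1)}(X)$ with $\varphi(X)\subseteq Y$ is $\mathcal{F}$-$\mathcal{G}$-compatible if, for each $\gamma\in\mathcal{F}$, either $\varphi\circ\gamma$ is constant or $(\varphi\circ\gamma)^{\mathrm{pl}}\in\mathfrak{m}(\mathcal{G})$.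 *)

theory Defs
  imports "HOL-Analysis.Analysis"
begin

text \<open>
  A path carries its parameter interval.  Its function is required to be \<^term>\<open>extensional\<close>
  on that interval, so that equality of paths, and hence membership in a collection of paths,
  depends only on the values on the interval.
\<close>

datatype cpath = Path (lo: real) (hi: real) (pfun: "real \<Rightarrow> complex")

definition dom :: "cpath \<Rightarrow> real set" where
  "dom \<gamma> = {lo \<gamma>..hi \<gamma>}"

definition is_path :: "cpath \<Rightarrow> bool" where
  "is_path \<gamma> \<longleftrightarrow> lo \<gamma> < hi \<gamma> \<and> continuous_on (dom \<gamma>) (pfun \<gamma>) \<and> pfun \<gamma> \<in> extensional (dom \<gamma>)"

definition initial_pt :: "cpath \<Rightarrow> complex" where
  "initial_pt \<gamma> = pfun \<gamma> (lo \<gamma>)"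

definition final_pt :: "cpath \<Rightarrow> complex" where
  "final_pt \<gamma> = pfun \<gamma> (hi \<gamma>)"

definition trace :: "cpath \<Rightarrow> complex set" where
  "trace \<gamma> = pfun \<gamma> ` dom \<gamma>"

definition path_in :: "complex set \<Rightarrow> cpath \<Rightarrow> bool" where
  "path_in X \<gamma> \<longleftrightarrow> is_path \<gamma> \<and> trace \<gamma> \<subseteq> X"

definition subpath_of :: "cpath \<Rightarrow> cpath \<Rightarrow> bool" where
  "subpath_of \<sigma> \<gamma> \<longleftrightarrow>
     lo \<gamma> \<le> lo \<sigma> \<and> lo \<sigma> < hi \<sigma> \<and> hi \<sigma> \<le> hi \<gamma> \<and> pfun \<sigma> = restrict (pfun \<gamma>) (dom \<sigma>)"

definition constant_path :: "cpath \<Rightarrow> bool" where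
  "constant_path \<gamma> \<longleftrightarrow> pfun \<gamma> constant_on dom \<gamma>"

text \<open>
  A partition of \<open>{c..d}\<close> is given by its set of subintervals.  Degenerate subintervals are
  allowed by \<^term>\<open>(division_of)\<close>, but contribute 0 to the sums below.
\<close>

definition variation_sums :: "cpath \<Rightarrow> real \<Rightarrow> real \<Rightarrow> real set" where
  "variation_sums \<gamma> c d =
     {\<Sum>K\<in>\<D>. norm (pfun \<gamma> (Sup K) - pfun \<gamma> (Inf K)) | \<D>. \<D> division_of {c..d}}"

definition rectifiable :: "cpath \<Rightarrow> bool" where
  "rectifiable \<gamma> \<longleftrightarrow> is_path \<gamma> \<and> bdd_above (variation_sums \<gamma> (lo \<gamma>) (hi \<gamma>))"

text \<open>Only meaningful for rectifiable paths, where the supremum is finite.\<close>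

definition variation :: "cpath \<Rightarrow> real \<Rightarrow> real \<Rightarrow> real" where
  "variation \<gamma> c d = Sup (variation_sums \<gamma> c d)"

definition path_len :: "cpath \<Rightarrow> real" where
  "path_len \<gamma> = variation \<gamma> (lo \<gamma>) (hi \<gamma>)"

definition jordan_path :: "cpath \<Rightarrow> bool" where
  "jordan_path \<gamma> \<longleftrightarrow> is_path \<gamma> \<and> inj_on (pfun \<gamma>) (dom \<gamma>)"

definition admissible :: "cpath \<Rightarrow> bool" where
  "admissible \<gamma> \<longleftrightarrow> rectifiable \<gamma> \<and> (\<forall>\<sigma>. subpath_of \<sigma> \<gamma> \<longrightarrow> \<not> constant_path \<sigma>)"

definition comp_path :: "(complex \<Rightarrow> complex) \<Rightarrow> cpath \<Rightarrow> cpath" where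
  "comp_path \<phi> \<gamma> = Path (lo \<gamma>) (hi \<gamma>) (compose (dom \<gamma>) \<phi> (pfun \<gamma>))"

definition path_length_param :: "cpath \<Rightarrow> cpath" where
  "path_length_param \<gamma> =
     (THE \<eta>. is_path \<eta> \<and> lo \<eta> = 0 \<and> hi \<eta> = path_len \<gamma> \<and>
             (\<forall>t\<in>dom \<gamma>. pfun \<eta> (variation \<gamma> (lo \<gamma>) t) = pfun \<gamma> t))"

text \<open>
  The Riemann-Stieltjes integral of \<open>f \<circ> \<gamma>\<close> with respect to \<open>\<gamma>\<close>, as the limit of
  the sums \<open>\<Sum> f (\<gamma> s\<^sub>i) (\<gamma> t\<^sub>i - \<gamma> t\<^sub>i\<^sub>-\<^sub>1)\<close> when the mesh of the tagged partition tends to 0.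
\<close>

definition has_path_integral ::
    "(complex \<Rightarrow> complex) \<Rightarrow> complex \<Rightarrow> cpath \<Rightarrow> bool" where
  "has_path_integral f I \<gamma> \<longleftrightarrow>
     (\<forall>\<epsilon>>0. \<exists>\<delta>>0. \<forall>p. p tagged_division_of dom \<gamma> \<and> (\<forall>(s, K)\<in>p. Sup K - Inf K < \<delta>) \<longrightarrow>
        norm ((\<Sum>(s, K)\<in>p. f (pfun \<gamma> s) * (pfun \<gamma> (Sup K) - pfun \<gamma> (Inf K))) - I) < \<epsilon>)"

definition compact_plane_set :: "complex set \<Rightarrow> bool" where
  "compact_plane_set X \<longleftrightarrow> X \<noteq> {} \<and> compact X"

definition semi_rectifiable :: "complex set \<Rightarrow> bool" where
  "semi_rectifiable X \<longleftrightarrow>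
     X \<subseteq> closure (\<Union>{trace \<gamma> | \<gamma>. path_in X \<gamma> \<and> rectifiable \<gamma> \<and> jordan_path \<gamma>})"

definition effective :: "complex set \<Rightarrow> cpath set \<Rightarrow> bool" where
  "effective X \<F> \<longleftrightarrow>
     (\<forall>\<gamma>\<in>\<F>. path_in X \<gamma>) \<and>
     X \<subseteq> closure (\<Union>\<gamma>\<in>\<F>. trace \<gamma>) \<and>
     (\<forall>\<gamma>\<in>\<F>. admissible \<gamma>) \<and>
     (\<forall>\<gamma>\<in>\<F>. \<forall>\<sigma>. subpath_of \<sigma> \<gamma> \<longrightarrow> \<sigma> \<in> \<F>)"

text \<open>
  Elements of $C(X)$ are represented by functions on \<open>\<complex>\<close> that are continuous on \<open>X\<close>; their
  values off \<open>X\<close> play no role.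
\<close>

definition is_F_derivative ::
    "complex set \<Rightarrow> cpath set \<Rightarrow> (complex \<Rightarrow> complex) \<Rightarrow> (complex \<Rightarrow> complex) \<Rightarrow> bool" where
  "is_F_derivative X \<F> f g \<longleftrightarrow>
     continuous_on X f \<and> continuous_on X g \<and>
     (\<forall>\<gamma>\<in>\<F>. has_path_integral g (f (final_pt \<gamma>) - f (initial_pt \<gamma>)) \<gamma>)"

text \<open>
  The derivative is unique as a function on \<open>X\<close>; the description picks its representative
  that is \<^term>\<open>undefined\<close> off \<open>X\<close>.
\<close>

definition F_deriv ::
    "complex set \<Rightarrow> cpath set \<Rightarrow> (complex \<Rightarrow> complex) \<Rightarrow> (complex \<Rightarrow> complex)" where
  "F_deriv X \<F> f = (THE g. g \<in> extensional X \<and> is_F_derivative X \<F> f g)"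

definition F_nth_deriv ::
    "complex set \<Rightarrow> cpath set \<Rightarrow> nat \<Rightarrow> (complex \<Rightarrow> complex) \<Rightarrow> (complex \<Rightarrow> complex)" where
  "F_nth_deriv X \<F> n f = (F_deriv X \<F> ^^ n) f"

definition F_differentiable :: "complex set \<Rightarrow> cpath set \<Rightarrow> (complex \<Rightarrow> complex) set" where
  "F_differentiable X \<F> = {f. \<exists>g. is_F_derivative X \<F> f g}"

text \<open>The case \<open>n = 0\<close> is only there for totality.\<close>

fun F_diff :: "complex set \<Rightarrow> cpath set \<Rightarrow> nat \<Rightarrow> (complex \<Rightarrow> complex) set" where
  "F_diff X \<F> 0 = {f. continuous_on X f}"
| "F_diff X \<F> (Suc 0) = F_differentiable X \<F>"
| "F_diff X \<F> (Suc (Suc n)) = {f \<in> F_differentiable X \<F>. F_deriv X \<F> f \<in> F_diff X \<F> (Suc n)}"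

definition is_path_derivative ::
    "complex set \<Rightarrow> cpath \<Rightarrow> (complex \<Rightarrow> complex) \<Rightarrow> (complex \<Rightarrow> complex) \<Rightarrow> bool" where
  "is_path_derivative Y \<gamma> f g \<longleftrightarrow>
     continuous_on Y f \<and> continuous_on Y g \<and>
     (\<forall>\<sigma>. subpath_of \<sigma> \<gamma> \<longrightarrow> has_path_integral g (f (final_pt \<sigma>) - f (initial_pt \<sigma>)) \<sigma>)"

definition max_collection :: "complex set \<Rightarrow> cpath set \<Rightarrow> cpath set" where
  "max_collection Y \<G> =
     {\<gamma>. path_in Y \<gamma> \<and> admissible \<gamma> \<and>
         (\<forall>f \<in> F_differentiable Y \<G>. is_path_derivative Y \<gamma> f (F_deriv Y \<G> f))}"

definition compatible ::
    "complex set \<Rightarrow> cpath set \<Rightarrow> complex set \<Rightarrow> cpath set \<Rightarrow> (complex \<Rightarrow> complex) \<Rightarrow> bool" where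
  "compatible X \<F> Y \<G> \<phi> \<longleftrightarrow>
     \<phi> \<in> F_differentiable X \<F> \<and> \<phi> ` X \<subseteq> Y \<and>
     (\<forall>\<gamma>\<in>\<F>. constant_path (comp_path \<phi> \<gamma>) \<or>
             path_length_param (comp_path \<phi> \<gamma>) \<in> max_collection Y \<G>)"

text \<open>
  The exponents $(a_1,\dots,a_k)$ with $\sum_j a_j = i$ and $\sum_j j a_j = k$, as extensional
  functions on \<open>{1..k}\<close>; the set is finite, since $a_j \le i$ for every $j$.
\<close>

definition faa_di_bruno_indices :: "nat \<Rightarrow> nat \<Rightarrow> (nat \<Rightarrow> nat) set" where
  "faa_di_bruno_indices k i =
     {a \<in> {1..k} \<rightarrow>\<^sub>E UNIV. (\<Sum>j=1..k. a j) = i \<and> (\<Sum>j=1..k. j * a j) = k}"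

lemma finite_faa_di_bruno_indices: "finite (faa_di_bruno_indices k i)"
proof (rule finite_subset)
  show "faa_di_bruno_indices k i \<subseteq> {1..k} \<rightarrow>\<^sub>E {..i}"
  proof
    fix a assume a: "a \<in> faa_di_bruno_indices k i"
    have "a j \<le> i" if "j \<in> {1..k}" for j
      using member_le_sum[OF that, of a] a by (simp add: faa_di_bruno_indices_def)
    with a show "a \<in> {1..k} \<rightarrow>\<^sub>E {..i}"
      unfolding faa_di_bruno_indices_def PiE_iff by blast
  qed
  show "finite ({1..k} \<rightarrow>\<^sub>E {..i})"
    by (rule finite_PiE) simp_all
qed

end

theory Submission
  imports Defs
begin

text \<open>
  The condition that \<open>g\<close> integrates to the increments of \<open>f\<close> over all subpaths of a rectifiable
  path \<open>\<gamma>\<close> is local.  It says that for nearby parameters \<open>c \<le> s \<le> d\<close>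

    \<open>|f (\<gamma> d) - f (\<gamma> c) - g (\<gamma> s) (\<gamma> d - \<gamma> c)| \<le> \<epsilon> (V d - V c)\<close>,

  uniformly in the parameters, where \<open>V t\<close> is the length of \<open>\<gamma>\<close> up to \<open>t\<close>
  (\<open>integral_imp_derivative_along\<close> and \<open>derivative_along_imp_integral\<close>).  The errors add up to
  \<open>\<epsilon>\<close> times the length of the subpath, so they vanish in the limit of Riemann-Stieltjes sums.
  In this form \<open>\<F>\<close>-derivatives can be treated like ordinary derivatives: uniqueness, the product
  rule and the chain rule are estimates with three parameters.

  In the chain rule, compatibility gives the local condition for \<open>f\<close> along the path length
  parametrisation of \<open>\<phi> \<circ> \<gamma>\<close>.  It moves to \<open>\<phi> \<circ> \<gamma>\<close> itself because arc length is continuous,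
  and then to \<open>\<gamma>\<close> because the arc length of \<open>\<phi> \<circ> \<gamma>\<close> is at most a constant times that of \<open>\<gamma>\<close>.
  All facts on arc length come from one description: it is the least function \<open>W\<close> with
  \<open>|\<gamma> y - \<gamma> x| \<le> W y - W x\<close> for \<open>x \<le> y\<close>, up to an additive constant (\<open>arclen_least\<close>).

  The combinatorics is done with the formal power series
  \<open>\<Phi> = \<Sum>\<^sub>j \<phi>\<^bsup>[j]\<^esup> t\<^sup>j / j!\<close> (over \<open>j \<ge> 1\<close>), whose coefficients are functions on \<open>X\<close>.  By the multinomial
  theorem the inner sum over the exponents is \<open>k!\<close> times the coefficient of \<open>t\<^sup>k\<close> in \<open>\<Phi>\<^sup>i / i!\<close>.
  Differentiating the coefficients of \<open>\<Phi>\<close> on \<open>X\<close> gives \<open>d\<Phi>/dt - \<phi>\<^bsup>[1]\<^esup>\<close>; hence by the product and chain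
  rules the derivative of the formula of order \<open>k\<close> is the formula of order \<open>k + 1\<close>: the terms that come
  from the correction \<open>\<phi>\<^bsup>[1]\<^esup>\<close> telescope against those that come from the derivatives of
  \<open>f\<^bsup>[i]\<^esup> \<circ> \<phi>\<close> (\<open>bell_recursion\<close> and \<open>composite_deriv_step\<close>).
\<close>

section \<open>Arc length\<close>

lemma sum_division_telescope:
  fixes h :: "real \<Rightarrow> real"
  assumes "\<D> division_of {a..b}" "a \<le> b"
  shows "(\<Sum>K\<in>\<D>. h (Sup K) - h (Inf K)) = h b - h a"
proof -
  let ?p = "(\<lambda>K. (Inf K, K)) ` \<D>"
  have Inf_in: "Inf K \<in> K" if "K \<in> \<D>" for K
    using division_ofD(3,4)[OF assms(1) that] by (auto simp: box_real)
  note D = division_ofD[OF assms(1)]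
  have eq: "{K. \<exists>x. (x, K) \<in> ?p} = \<D>" by (rule set_eqI) (simp add: image_iff)
  have "?p tagged_division_of {a..b}"
  proof (rule tagged_division_ofI)
    show "finite ?p" using D(1) by simp
    show "\<Union>{K. \<exists>x. (x, K) \<in> ?p} = {a..b}" unfolding eq by (rule D(6))
    fix x K assume "(x, K) \<in> ?p"
    then have xK: "x = Inf K" "K \<in> \<D>" by (simp_all add: image_iff)
    show "x \<in> K" using Inf_in xK by simp
    show "K \<subseteq> {a..b}" by (rule D(2)[OF xK(2)])
    show "\<exists>a b. K = cbox a b" by (rule D(4)[OF xK(2)])
    fix x' K' assume "(x', K') \<in> ?p" "(x, K) \<noteq> (x', K')"
    then have xK': "K' \<in> \<D>" "K \<noteq> K'" using xK by (auto simp: image_iff)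
    show "interior K \<inter> interior K' = {}" by (rule D(5)[OF xK(2) xK'])
  qed
  from additive_tagged_division_1[OF assms(2) this, of h] show ?thesis
    by (subst (asm) sum.reindex) (auto simp: inj_on_def)
qed

lemma division_interval:
  assumes "\<D> division_of {c..d}" "K \<in> \<D>"
  shows "c \<le> Inf K" "Inf K \<le> Sup K" "Sup K \<le> (d::real)"
  using division_ofD(2-4)[OF assms] by (auto simp: box_real)

lemma tagged_division_interval:
  assumes "p tagged_division_of {c..d}" "(s, K) \<in> p"
  shows "c \<le> Inf K" "Inf K \<le> s" "s \<le> Sup K" "Sup K \<le> (d::real)"
  using tagged_division_ofD(2-4)[OF assms] by (auto simp: box_real)

lemma variation_sums_le:
  assumes "v \<in> variation_sums \<gamma> c d" "c \<le> d"
    and W: "\<And>x y. c \<le> x \<Longrightarrow> x \<le> y \<Longrightarrow> y \<le> d \<Longrightarrow> norm (pfun \<gamma> y - pfun \<gamma> x) \<le> W y - W x"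
  shows "v \<le> W d - W c"
proof -
  obtain \<D> where \<D>: "\<D> division_of {c..d}"
    and v: "v = (\<Sum>K\<in>\<D>. norm (pfun \<gamma> (Sup K) - pfun \<gamma> (Inf K)))"
    using assms(1) unfolding variation_sums_def by blast
  have "v \<le> (\<Sum>K\<in>\<D>. W (Sup K) - W (Inf K))"
    unfolding v by (intro sum_mono W division_interval[OF \<D>])
  with sum_division_telescope[OF \<D> \<open>c \<le> d\<close>, of W] show ?thesis by simp
qed

lemma variation_sumsI:
  assumes "\<D> division_of {c..d}"
    and "v = (\<Sum>K\<in>\<D>. norm (pfun \<gamma> (Sup K) - pfun \<gamma> (Inf K)))"
  shows "v \<in> variation_sums \<gamma> c d"
  unfolding variation_sums_def mem_Collect_eq by (rule exI[of _ \<D>]) (use assms in simp)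

lemma variation_sums_trivial:
  assumes "c \<le> d"
  shows "norm (pfun \<gamma> d - pfun \<gamma> c) \<in> variation_sums \<gamma> c d"
proof -
  have "{{c..d}} division_of {c..d}"
    using division_of_self[of c d] assms by (simp add: box_real)
  then show ?thesis
    using assms by (intro variation_sumsI[of "{{c..d}}"]) auto
qed

text \<open>
  A degenerate interval \<open>{d}\<close> may occur in both divisions, but it contributes 0.
\<close>

lemma variation_sums_extend:
  assumes "v \<in> variation_sums \<gamma> c d" "c \<le> d" "d \<le> e"
  shows "v + norm (pfun \<gamma> e - pfun \<gamma> d) \<in> variation_sums \<gamma> c e"
proof -
  let ?h = "\<lambda>K. norm (pfun \<gamma> (Sup K) - pfun \<gamma> (Inf K))"
  obtain \<D> where \<D>: "\<D> division_of {c..d}" and v: "v = (\<Sum>K\<in>\<D>. ?h K)"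
    using assms(1) unfolding variation_sums_def by blast
  have E: "{{d..e}} division_of {d..e}"
    using division_of_self[of d e] assms by (simp add: box_real)
  have "(\<D> \<union> {{d..e}}) division_of ({c..d} \<union> {d..e})"
    by (rule division_disjoint_union[OF \<D> E]) (auto simp: interior_atLeastAtMost_real)
  moreover have "{c..d} \<union> {d..e} = {c..e}" using assms by auto
  moreover have "(\<Sum>K\<in>\<D> \<union> {{d..e}}. ?h K) = v + (\<Sum>K\<in>{{d..e}}. ?h K)"
    unfolding v
  proof (rule sum.union_inter_neutral)
    show "\<forall>K\<in>\<D> \<inter> {{d..e}}. ?h K = 0"
    proof
      fix K assume K: "K \<in> \<D> \<inter> {{d..e}}"
      then have "Sup K \<le> d" "d \<le> Inf K" "Inf K \<le> Sup K"
        using division_interval[OF \<D>, of K] division_interval[OF E, of K] by auto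
      then have "Sup K = Inf K" by linarith
      then show "?h K = 0" by simp
    qed
  qed (simp_all add: division_of_finite[OF \<D>])
  ultimately show ?thesis
    using assms(3) by (intro variation_sumsI[of "\<D> \<union> {{d..e}}"]) simp_all
qed

abbreviation arclen :: "cpath \<Rightarrow> real \<Rightarrow> real" where
  "arclen \<gamma> t \<equiv> variation \<gamma> (lo \<gamma>) t"

lemma bdd_above_variation_sums:
  assumes "rectifiable \<gamma>" "lo \<gamma> \<le> t" "t \<le> hi \<gamma>"
  shows "bdd_above (variation_sums \<gamma> (lo \<gamma>) t)"
proof -
  obtain B where B: "\<And>v. v \<in> variation_sums \<gamma> (lo \<gamma>) (hi \<gamma>) \<Longrightarrow> v \<le> B"
    using assms(1) unfolding rectifiable_def bdd_above_def by blast
  show ?thesis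
  proof (rule bdd_aboveI)
    fix v assume "v \<in> variation_sums \<gamma> (lo \<gamma>) t"
    from B[OF variation_sums_extend[OF this assms(2,3)]] show "v \<le> B"
      using norm_ge_zero[of "pfun \<gamma> (hi \<gamma>) - pfun \<gamma> t"] by linarith
  qed
qed

lemma arclen_lo: "arclen \<gamma> (lo \<gamma>) = 0"
proof -
  have "variation_sums \<gamma> (lo \<gamma>) (lo \<gamma>) = {0}"
    using variation_sums_trivial[of "lo \<gamma>" "lo \<gamma>" \<gamma>]
      division_of_sing[of _ "lo \<gamma>"]
    by (auto simp: variation_sums_def box_real)
  then show ?thesis by (simp add: variation_def)
qed

lemma norm_le_arclen:
  assumes "rectifiable \<gamma>" "lo \<gamma> \<le> c" "c \<le> d" "d \<le> hi \<gamma>"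
  shows "norm (pfun \<gamma> d - pfun \<gamma> c) \<le> arclen \<gamma> d - arclen \<gamma> c"
proof -
  have "arclen \<gamma> c \<le> arclen \<gamma> d - norm (pfun \<gamma> d - pfun \<gamma> c)"
    unfolding variation_def
  proof (rule cSup_least)
    show "variation_sums \<gamma> (lo \<gamma>) c \<noteq> {}"
      using variation_sums_trivial[OF assms(2)] by blast
    fix v assume "v \<in> variation_sums \<gamma> (lo \<gamma>) c"
    then have "v + norm (pfun \<gamma> d - pfun \<gamma> c) \<in> variation_sums \<gamma> (lo \<gamma>) d"
      by (rule variation_sums_extend) (use assms in auto)
    then have "v + norm (pfun \<gamma> d - pfun \<gamma> c) \<le> Sup (variation_sums \<gamma> (lo \<gamma>) d)"
      by (rule cSup_upper) (use assms in \<open>auto intro!: bdd_above_variation_sums\<close>)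
    then show "v \<le> Sup (variation_sums \<gamma> (lo \<gamma>) d) - norm (pfun \<gamma> d - pfun \<gamma> c)" by simp
  qed
  then show ?thesis by simp
qed

lemma arclen_mono:
  assumes "rectifiable \<gamma>" "lo \<gamma> \<le> c" "c \<le> d" "d \<le> hi \<gamma>"
  shows "arclen \<gamma> c \<le> arclen \<gamma> d"
  using norm_le_arclen[OF assms] norm_ge_zero[of "pfun \<gamma> d - pfun \<gamma> c"] by linarith

text \<open>
  Along with \<open>norm_le_arclen\<close> this determines arc length up to a constant: a function
  whose increments dominate the chords grows at least as fast.  On an inner interval \<open>{c..d}\<close> the
  dominating function is prolonged to the left by arc length itself, which reduces the
  claim to the bound \<open>variation_sums_le\<close> for divisions of an interval that starts at \<open>lo \<gamma>\<close>.
\<close>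

lemma arclen_least:
  assumes "rectifiable \<gamma>" "lo \<gamma> \<le> c" "c \<le> d" "d \<le> hi \<gamma>"
    and W: "\<And>x y. c \<le> x \<Longrightarrow> x \<le> y \<Longrightarrow> y \<le> d \<Longrightarrow> norm (pfun \<gamma> y - pfun \<gamma> x) \<le> W y - W x"
  shows "arclen \<gamma> d - arclen \<gamma> c \<le> W d - W c"
proof -
  define U where "U t = (if t \<le> c then arclen \<gamma> t else arclen \<gamma> c + (W t - W c))" for t
  have U: "norm (pfun \<gamma> y - pfun \<gamma> x) \<le> U y - U x" if "lo \<gamma> \<le> x" "x \<le> y" "y \<le> d" for x y
  proof -
    consider "y \<le> c" | "c < x" | "x \<le> c" "c < y" by linarith
    then show ?thesis
    proof cases
      case 1
      then show ?thesis using norm_le_arclen[OF assms(1), of x y] that assms by (simp add: U_def)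
    next
      case 2
      then show ?thesis using W[of x y] that by (simp add: U_def)
    next
      case 3
      have "norm (pfun \<gamma> y - pfun \<gamma> x) \<le> norm (pfun \<gamma> y - pfun \<gamma> c) + norm (pfun \<gamma> c - pfun \<gamma> x)"
        by (metis diff_add_cancel add_diff_eq norm_triangle_ineq)
      also have "\<dots> \<le> (W y - W c) + (arclen \<gamma> c - arclen \<gamma> x)"
        using W[of c y] norm_le_arclen[OF assms(1), of x c] that 3 assms by (intro add_mono) auto
      finally show ?thesis using 3 by (simp add: U_def)
    qed
  qed
  have "arclen \<gamma> d \<le> U d - U (lo \<gamma>)"
    unfolding variation_def
  proof (rule cSup_least)
    show "variation_sums \<gamma> (lo \<gamma>) d \<noteq> {}"
      using variation_sums_trivial[of "lo \<gamma>" d \<gamma>] assms by auto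
    show "v \<le> U d - U (lo \<gamma>)" if "v \<in> variation_sums \<gamma> (lo \<gamma>) d" for v
      using variation_sums_le[OF that _ U] assms by auto
  qed
  moreover have "U (lo \<gamma>) = 0" using assms(2) by (simp add: U_def arclen_lo)
  moreover have "U d = arclen \<gamma> c + (W d - W c)" using assms(3) by (simp add: U_def)
  ultimately show ?thesis by simp
qed

lemma rectifiable_if_dominated:
  assumes "is_path \<gamma>"
    and "\<And>x y. lo \<gamma> \<le> x \<Longrightarrow> x \<le> y \<Longrightarrow> y \<le> hi \<gamma> \<Longrightarrow> norm (pfun \<gamma> y - pfun \<gamma> x) \<le> W y - W x"
  shows "rectifiable \<gamma>"
  unfolding rectifiable_def
proof
  show "bdd_above (variation_sums \<gamma> (lo \<gamma>) (hi \<gamma>))"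
    by (rule bdd_aboveI, rule variation_sums_le)
      (use assms in \<open>auto simp: is_path_def\<close>)
qed (fact assms)

lemma path_near:
  assumes "is_path \<gamma>" "p \<in> dom \<gamma>" "\<epsilon> > 0"
  obtains \<delta> where "\<delta> > 0" "\<And>x. x \<in> dom \<gamma> \<Longrightarrow> \<bar>x - p\<bar> < \<delta> \<Longrightarrow> norm (pfun \<gamma> p - pfun \<gamma> x) < \<epsilon>"
proof -
  have "continuous_on (dom \<gamma>) (pfun \<gamma>)" using assms(1) by (simp add: is_path_def)
  then obtain \<delta> where \<delta>: "\<delta> > 0"
      "\<forall>x\<in>dom \<gamma>. dist x p < \<delta> \<longrightarrow> dist (pfun \<gamma> x) (pfun \<gamma> p) < \<epsilon>"
    using assms(2,3) unfolding continuous_on_iff by blast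
  show thesis
  proof (rule that[OF \<delta>(1)])
    fix x assume "x \<in> dom \<gamma>" "\<bar>x - p\<bar> < \<delta>"
    with \<delta>(2) show "norm (pfun \<gamma> p - pfun \<gamma> x) < \<epsilon>"
      by (simp add: dist_norm norm_minus_commute[of "pfun \<gamma> p"])
  qed
qed

text \<open>
  If arc length jumped at \<open>p\<close>, then removing the jump would leave a function that still dominates
  the chords, since the path is continuous at \<open>p\<close>.  This contradicts minimality.
\<close>

lemma arclen_no_left_jump:
  assumes "rectifiable \<gamma>" "lo \<gamma> < p" "p \<le> hi \<gamma>" "\<epsilon> > 0"
  shows "\<exists>x. lo \<gamma> \<le> x \<and> x < p \<and> arclen \<gamma> p - arclen \<gamma> x < \<epsilon>"
proof (rule ccontr)
  assume contra: "\<not> ?thesis"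
  have jump: "arclen \<gamma> x \<le> arclen \<gamma> p - \<epsilon>" if "lo \<gamma> \<le> x" "x < p" for x
    using contra that by force
  have path: "is_path \<gamma>" using assms(1) by (simp add: rectifiable_def)
  define W where "W t = (if t < p then arclen \<gamma> t else arclen \<gamma> t - \<epsilon>)" for t
  have left: "norm (pfun \<gamma> p - pfun \<gamma> x) \<le> arclen \<gamma> p - \<epsilon> - arclen \<gamma> x"
    if x: "lo \<gamma> \<le> x" "x < p" for x
  proof (rule field_le_epsilon)
    fix e :: real assume "e > 0"
    obtain \<delta> where \<delta>: "\<delta> > 0"
        "\<And>y. y \<in> dom \<gamma> \<Longrightarrow> \<bar>y - p\<bar> < \<delta> \<Longrightarrow> norm (pfun \<gamma> p - pfun \<gamma> y) < e"
      using path_near[OF path _ \<open>e > 0\<close>, of p] assms by (auto simp: dom_def)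
    define y where "y = max x (p - \<delta> / 2)"
    have y: "x \<le> y" "y < p" "\<bar>y - p\<bar> < \<delta>" using x \<delta>(1) by (auto simp: y_def)
    have "norm (pfun \<gamma> p - pfun \<gamma> x) \<le> norm (pfun \<gamma> p - pfun \<gamma> y) + norm (pfun \<gamma> y - pfun \<gamma> x)"
      by (metis diff_add_cancel add_diff_eq norm_triangle_ineq)
    also have "\<dots> \<le> e + (arclen \<gamma> y - arclen \<gamma> x)"
      using norm_le_arclen[OF assms(1), of x y] \<delta>(2)[of y] x y assms
      by (intro add_mono) (auto simp: dom_def)
    also have "arclen \<gamma> y \<le> arclen \<gamma> p - \<epsilon>" using jump[of y] x y by auto
    finally show "norm (pfun \<gamma> p - pfun \<gamma> x) \<le> arclen \<gamma> p - \<epsilon> - arclen \<gamma> x + e" by simp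
  qed
  have "arclen \<gamma> p - arclen \<gamma> (lo \<gamma>) \<le> W p - W (lo \<gamma>)"
  proof (rule arclen_least[OF assms(1)])
    fix x y assume xy: "lo \<gamma> \<le> x" "x \<le> y" "y \<le> p"
    show "norm (pfun \<gamma> y - pfun \<gamma> x) \<le> W y - W x"
      using norm_le_arclen[OF assms(1), of x y] left[of x] xy assms
      by (cases "x < p"; cases "y = p") (auto simp: W_def)
  qed (use assms in auto)
  then show False using assms by (simp add: W_def)
qed

lemma arclen_no_right_jump:
  assumes "rectifiable \<gamma>" "lo \<gamma> \<le> p" "p < hi \<gamma>" "\<epsilon> > 0"
  shows "\<exists>x. p < x \<and> x \<le> hi \<gamma> \<and> arclen \<gamma> x - arclen \<gamma> p < \<epsilon>"
proof (rule ccontr)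
  assume contra: "\<not> ?thesis"
  have jump: "arclen \<gamma> p + \<epsilon> \<le> arclen \<gamma> x" if "p < x" "x \<le> hi \<gamma>" for x
    using contra that by force
  have path: "is_path \<gamma>" using assms(1) by (simp add: rectifiable_def)
  define W where "W t = (if t \<le> p then arclen \<gamma> t else arclen \<gamma> t - \<epsilon>)" for t
  have right: "norm (pfun \<gamma> x - pfun \<gamma> p) \<le> arclen \<gamma> x - \<epsilon> - arclen \<gamma> p"
    if x: "p < x" "x \<le> hi \<gamma>" for x
  proof (rule field_le_epsilon)
    fix e :: real assume "e > 0"
    obtain \<delta> where \<delta>: "\<delta> > 0"
        "\<And>y. y \<in> dom \<gamma> \<Longrightarrow> \<bar>y - p\<bar> < \<delta> \<Longrightarrow> norm (pfun \<gamma> p - pfun \<gamma> y) < e"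
      using path_near[OF path _ \<open>e > 0\<close>, of p] assms by (auto simp: dom_def)
    define y where "y = min x (p + \<delta> / 2)"
    have y: "y \<le> x" "p < y" "\<bar>y - p\<bar> < \<delta>" using x \<delta>(1) by (auto simp: y_def)
    have "norm (pfun \<gamma> x - pfun \<gamma> p) \<le> norm (pfun \<gamma> x - pfun \<gamma> y) + norm (pfun \<gamma> p - pfun \<gamma> y)"
      by (metis diff_add_cancel add_diff_eq norm_triangle_ineq norm_minus_commute)
    also have "\<dots> \<le> (arclen \<gamma> x - arclen \<gamma> y) + e"
      using norm_le_arclen[OF assms(1), of y x] \<delta>(2)[of y] x y assms
      by (intro add_mono) (auto simp: dom_def)
    also have "\<dots> \<le> arclen \<gamma> x - \<epsilon> - arclen \<gamma> p + e" using jump[of y] x y by auto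
    finally show "norm (pfun \<gamma> x - pfun \<gamma> p) \<le> arclen \<gamma> x - \<epsilon> - arclen \<gamma> p + e" .
  qed
  have "arclen \<gamma> (hi \<gamma>) - arclen \<gamma> p \<le> W (hi \<gamma>) - W p"
  proof (rule arclen_least[OF assms(1)])
    fix x y assume xy: "p \<le> x" "x \<le> y" "y \<le> hi \<gamma>"
    show "norm (pfun \<gamma> y - pfun \<gamma> x) \<le> W y - W x"
      using norm_le_arclen[OF assms(1), of x y] right[of y] xy assms
      by (cases "x = p"; cases "y = p") (auto simp: W_def)
  qed (use assms in auto)
  then show False using assms by (simp add: W_def)
qed

lemma continuous_on_arclen:
  assumes "rectifiable \<gamma>"
  shows "continuous_on (dom \<gamma>) (arclen \<gamma>)"
  unfolding continuous_on_iff
proof (intro ballI allI impI)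
  fix p and \<epsilon> :: real assume p: "p \<in> dom \<gamma>" and \<epsilon>: "\<epsilon> > 0"
  have "\<exists>d>0. \<forall>x\<in>dom \<gamma>. p - d < x \<and> x \<le> p \<longrightarrow> arclen \<gamma> p - arclen \<gamma> x < \<epsilon>"
  proof (cases "p = lo \<gamma>")
    case True
    then show ?thesis using \<epsilon> by (intro exI[of _ 1]) (auto simp: dom_def)
  next
    case False
    then obtain x0 where x0: "lo \<gamma> \<le> x0" "x0 < p" "arclen \<gamma> p - arclen \<gamma> x0 < \<epsilon>"
      using arclen_no_left_jump[OF assms _ _ \<epsilon>, of p] p by (auto simp: dom_def)
    have "arclen \<gamma> x0 \<le> arclen \<gamma> x" if "x0 < x" "x \<in> dom \<gamma>" for x
      using arclen_mono[OF assms, of x0 x] that x0 by (auto simp: dom_def)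
    with x0 show ?thesis by (intro exI[of _ "p - x0"]) force
  qed
  then obtain d1 where d1: "d1 > 0"
    "\<And>x. x \<in> dom \<gamma> \<Longrightarrow> p - d1 < x \<Longrightarrow> x \<le> p \<Longrightarrow> arclen \<gamma> p - arclen \<gamma> x < \<epsilon>" by blast
  have "\<exists>d>0. \<forall>x\<in>dom \<gamma>. p \<le> x \<and> x < p + d \<longrightarrow> arclen \<gamma> x - arclen \<gamma> p < \<epsilon>"
  proof (cases "p = hi \<gamma>")
    case True
    then show ?thesis using \<epsilon> by (intro exI[of _ 1]) (auto simp: dom_def)
  next
    case False
    then obtain x0 where x0: "p < x0" "x0 \<le> hi \<gamma>" "arclen \<gamma> x0 - arclen \<gamma> p < \<epsilon>"
      using arclen_no_right_jump[OF assms _ _ \<epsilon>, of p] p by (auto simp: dom_def)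
    have "arclen \<gamma> x \<le> arclen \<gamma> x0" if "x < x0" "x \<in> dom \<gamma>" for x
      using arclen_mono[OF assms, of x x0] that x0 by (auto simp: dom_def)
    with x0 show ?thesis by (intro exI[of _ "x0 - p"]) force
  qed
  then obtain d2 where d2: "d2 > 0"
    "\<And>x. x \<in> dom \<gamma> \<Longrightarrow> p \<le> x \<Longrightarrow> x < p + d2 \<Longrightarrow> arclen \<gamma> x - arclen \<gamma> p < \<epsilon>" by blast
  show "\<exists>d>0. \<forall>x\<in>dom \<gamma>. dist x p < d \<longrightarrow> dist (arclen \<gamma> x) (arclen \<gamma> p) < \<epsilon>"
  proof (intro exI[of _ "min d1 d2"] conjI ballI impI)
    fix x assume x: "x \<in> dom \<gamma>" "dist x p < min d1 d2"
    show "dist (arclen \<gamma> x) (arclen \<gamma> p) < \<epsilon>"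
    proof (cases "x \<le> p")
      case True
      then show ?thesis using d1(2)[of x] x arclen_mono[OF assms, of x p] p
        by (auto simp: dist_real_def dom_def)
    next
      case False
      then show ?thesis using d2(2)[of x] x arclen_mono[OF assms, of p x] p
        by (auto simp: dist_real_def dom_def)
    qed
  qed (use d1 d2 in auto)
qed

section \<open>Derivatives along a path\<close>

text \<open>
  This is differentiability of \<open>F\<close> with respect to \<open>\<gamma>\<close>, uniform in the parameter and
  with the error measured by arc length instead of by \<open>|\<gamma> d - \<gamma> c|\<close>: errors of
  this kind can be summed over a division.
\<close>

definition derivative_along :: "cpath \<Rightarrow> (real \<Rightarrow> complex) \<Rightarrow> (real \<Rightarrow> complex) \<Rightarrow> bool" where
  "derivative_along \<gamma> F G \<longleftrightarrow>
     (\<forall>\<epsilon>>0. \<exists>\<delta>>0. \<forall>c s d. lo \<gamma> \<le> c \<and> c \<le> s \<and> s \<le> d \<and> d \<le> hi \<gamma> \<and> d - c < \<delta> \<longrightarrow>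
        norm (F d - F c - G s * (pfun \<gamma> d - pfun \<gamma> c)) \<le> \<epsilon> * (arclen \<gamma> d - arclen \<gamma> c))"

lemma derivative_alongD:
  assumes "derivative_along \<gamma> F G" "\<epsilon> > 0"
  obtains \<delta> where "\<delta> > 0"
    "\<And>c s d. lo \<gamma> \<le> c \<Longrightarrow> c \<le> s \<Longrightarrow> s \<le> d \<Longrightarrow> d \<le> hi \<gamma> \<Longrightarrow> d - c < \<delta> \<Longrightarrow>
        norm (F d - F c - G s * (pfun \<gamma> d - pfun \<gamma> c)) \<le> \<epsilon> * (arclen \<gamma> d - arclen \<gamma> c)"
  using assms unfolding derivative_along_def by meson

lemma bounded_on_dom:
  fixes G :: "real \<Rightarrow> complex"
  assumes "continuous_on (dom \<gamma>) G"
  obtains B where "B \<ge> 0" "\<And>t. t \<in> dom \<gamma> \<Longrightarrow> norm (G t) \<le> B"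
proof -
  have "bounded (G ` dom \<gamma>)"
    using assms by (intro compact_imp_bounded compact_continuous_image) (simp_all add: dom_def)
  then obtain B where "B > 0" "\<forall>x\<in>G ` dom \<gamma>. norm x \<le> B" unfolding bounded_pos by blast
  then show thesis by (intro that[of B]) simp_all
qed

lemma uniform_on_dom:
  fixes G :: "real \<Rightarrow> complex"
  assumes "continuous_on (dom \<gamma>) G" "e > 0"
  obtains \<delta> where "\<delta> > 0"
    "\<And>x s. x \<in> dom \<gamma> \<Longrightarrow> s \<in> dom \<gamma> \<Longrightarrow> \<bar>x - s\<bar> < \<delta> \<Longrightarrow> norm (G x - G s) < e"
proof -
  have "uniformly_continuous_on (dom \<gamma>) G"
    by (rule compact_uniformly_continuous[OF assms(1)]) (simp add: dom_def)
  then obtain \<delta> where "\<delta> > 0"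
    and "\<forall>s\<in>dom \<gamma>. \<forall>x\<in>dom \<gamma>. dist x s < \<delta> \<longrightarrow> dist (G x) (G s) < e"
    unfolding uniformly_continuous_on_def using \<open>e > 0\<close> by blast
  then show thesis by (intro that[of \<delta>]) (simp_all add: dist_norm)
qed

lemma derivative_along_cong:
  assumes "\<And>t. t \<in> dom \<gamma> \<Longrightarrow> F t = F' t" "\<And>t. t \<in> dom \<gamma> \<Longrightarrow> G t = G' t"
  shows "derivative_along \<gamma> F G \<longleftrightarrow> derivative_along \<gamma> F' G'"
proof -
  have "(lo \<gamma> \<le> c \<and> c \<le> s \<and> s \<le> d \<and> d \<le> hi \<gamma> \<and> d - c < \<delta> \<longrightarrow>
        norm (F d - F c - G s * (pfun \<gamma> d - pfun \<gamma> c)) \<le> \<epsilon> * (arclen \<gamma> d - arclen \<gamma> c)) \<longleftrightarrow>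
      (lo \<gamma> \<le> c \<and> c \<le> s \<and> s \<le> d \<and> d \<le> hi \<gamma> \<and> d - c < \<delta> \<longrightarrow>
        norm (F' d - F' c - G' s * (pfun \<gamma> d - pfun \<gamma> c)) \<le> \<epsilon> * (arclen \<gamma> d - arclen \<gamma> c))"
    for c s d \<delta> \<epsilon> :: real
    using assms by (auto simp: dom_def)
  then show ?thesis unfolding derivative_along_def by (simp only:)
qed

lemma fine_tagged_division:
  assumes "\<delta> > (0::real)"
  obtains p where "p tagged_division_of {c..d}" "\<And>s K. (s, K) \<in> p \<Longrightarrow> Sup K - Inf K < \<delta>"
proof -
  obtain p where p: "p tagged_division_of {c..d}" "(\<lambda>x. ball x (\<delta> / 2)) fine p"
    using fine_division_exists_real[OF gauge_ball[of "\<delta> / 2"]] assms by auto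
  have "Sup K - Inf K < \<delta>" if sK: "(s, K) \<in> p" for s K
  proof -
    obtain a b where K: "K = {a..b}" "a \<le> b"
      using tagged_division_ofD(2,4)[OF p(1) sK] by (auto simp: box_real)
    with fineD[OF p(2) sK] have "a \<in> ball s (\<delta> / 2)" "b \<in> ball s (\<delta> / 2)" by auto
    then have "\<bar>s - a\<bar> < \<delta> / 2" "\<bar>s - b\<bar> < \<delta> / 2" by (simp_all only: mem_ball dist_real_def)
    with K show ?thesis by (simp del: less_divide_eq_numeral1)
  qed
  with p(1) that show thesis by blast
qed

lemma sum_tagged_le:
  fixes A :: "real \<times> real set \<Rightarrow> complex"
  assumes "p tagged_division_of {c..d}" "c \<le> (d::real)"
    and "\<And>s K. (s, K) \<in> p \<Longrightarrow> norm (A (s, K)) \<le> B * (W (Sup K) - W (Inf K))"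
  shows "norm (\<Sum>x\<in>p. A x) \<le> B * (W d - W c)"
proof -
  have "norm (\<Sum>x\<in>p. A x) \<le> (\<Sum>(s, K)\<in>p. B * (W (Sup K) - W (Inf K)))"
    using assms(3) by (intro sum_norm_le) auto
  also have "\<dots> = B * (\<Sum>(s, K)\<in>p. W (Sup K) - W (Inf K))"
    by (simp add: sum_distrib_left case_prod_unfold)
  also have "\<dots> = B * (W d - W c)"
    using additive_tagged_division_1[OF assms(2,1), of W] by simp
  finally show ?thesis .
qed

lemma subpath_pfun:
  assumes "subpath_of \<sigma> \<gamma>" "lo \<sigma> \<le> t" "t \<le> hi \<sigma>"
  shows "pfun \<sigma> t = pfun \<gamma> t"
  using assms by (simp add: subpath_of_def dom_def)

text \<open>
  The errors of the terms of a fine Riemann-Stieltjes sum add up to at most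
  \<open>\<epsilon>\<close> times the length of the subpath.
\<close>

lemma derivative_along_imp_integral:
  assumes "rectifiable \<gamma>"
    and along: "derivative_along \<gamma> (\<lambda>t. f (pfun \<gamma> t)) (\<lambda>t. g (pfun \<gamma> t))"
    and \<sigma>: "subpath_of \<sigma> \<gamma>"
  shows "has_path_integral g (f (final_pt \<sigma>) - f (initial_pt \<sigma>)) \<sigma>"
  unfolding has_path_integral_def
proof (intro allI impI)
  fix \<epsilon> :: real assume "\<epsilon> > 0"
  let ?c = "lo \<sigma>" and ?d = "hi \<sigma>"
  have cd: "lo \<gamma> \<le> ?c" "?c < ?d" "?d \<le> hi \<gamma>" using \<sigma> by (auto simp: subpath_of_def)
  define L where "L = arclen \<gamma> ?d - arclen \<gamma> ?c"
  have L: "L \<ge> 0" using arclen_mono[OF assms(1), of ?c ?d] cd by (simp add: L_def)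
  define e where "e = \<epsilon> / (L + 1)"
  have e: "e > 0" "e * L < \<epsilon>" using L \<open>\<epsilon> > 0\<close> by (auto simp: e_def field_simps)
  obtain \<delta> where \<delta>: "\<delta> > 0"
    "\<And>c s d. lo \<gamma> \<le> c \<Longrightarrow> c \<le> s \<Longrightarrow> s \<le> d \<Longrightarrow> d \<le> hi \<gamma> \<Longrightarrow> d - c < \<delta> \<Longrightarrow>
        norm (f (pfun \<gamma> d) - f (pfun \<gamma> c) - g (pfun \<gamma> s) * (pfun \<gamma> d - pfun \<gamma> c))
          \<le> e * (arclen \<gamma> d - arclen \<gamma> c)"
    using derivative_alongD[OF along e(1)] by blast
  show "\<exists>\<delta>>0. \<forall>p. p tagged_division_of dom \<sigma> \<and> (\<forall>(s, K)\<in>p. Sup K - Inf K < \<delta>) \<longrightarrow>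
        norm ((\<Sum>(s, K)\<in>p. g (pfun \<sigma> s) * (pfun \<sigma> (Sup K) - pfun \<sigma> (Inf K)))
          - (f (final_pt \<sigma>) - f (initial_pt \<sigma>))) < \<epsilon>"
  proof (intro exI[of _ \<delta>] conjI allI impI \<delta>(1), elim conjE)
    fix p assume "p tagged_division_of dom \<sigma>" and fine: "\<forall>(s, K)\<in>p. Sup K - Inf K < \<delta>"
    then have p: "p tagged_division_of {?c..?d}" by (simp add: dom_def)
    note tdi = tagged_division_interval[OF p]
    have "f (final_pt \<sigma>) - f (initial_pt \<sigma>) =
        (\<Sum>(s, K)\<in>p. f (pfun \<gamma> (Sup K)) - f (pfun \<gamma> (Inf K)))"
      using additive_tagged_division_1[OF _ p, of "\<lambda>t. f (pfun \<gamma> t)"] cd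
        subpath_pfun[OF \<sigma>, of ?c] subpath_pfun[OF \<sigma>, of ?d]
      by (simp add: final_pt_def initial_pt_def)
    moreover have "(\<Sum>(s, K)\<in>p. g (pfun \<sigma> s) * (pfun \<sigma> (Sup K) - pfun \<sigma> (Inf K))) =
        (\<Sum>(s, K)\<in>p. g (pfun \<gamma> s) * (pfun \<gamma> (Sup K) - pfun \<gamma> (Inf K)))"
    proof (intro sum.cong refl, clarify)
      fix s K assume "(s, K) \<in> p"
      from tdi[OF this] show "g (pfun \<sigma> s) * (pfun \<sigma> (Sup K) - pfun \<sigma> (Inf K)) =
          g (pfun \<gamma> s) * (pfun \<gamma> (Sup K) - pfun \<gamma> (Inf K))"
        by (simp add: subpath_pfun[OF \<sigma>])
    qed
    ultimately have "norm ((\<Sum>(s, K)\<in>p. g (pfun \<sigma> s) * (pfun \<sigma> (Sup K) - pfun \<sigma> (Inf K)))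
          - (f (final_pt \<sigma>) - f (initial_pt \<sigma>))) =
        norm (\<Sum>(s, K)\<in>p. f (pfun \<gamma> (Sup K)) - f (pfun \<gamma> (Inf K))
          - g (pfun \<gamma> s) * (pfun \<gamma> (Sup K) - pfun \<gamma> (Inf K)))"
      by (simp add: sum_subtractf case_prod_unfold norm_minus_commute)
    also have "\<dots> \<le> e * L"
      unfolding L_def
    proof (rule sum_tagged_le[OF p])
      fix s K assume sK: "(s, K) \<in> p"
      have "norm (f (pfun \<gamma> (Sup K)) - f (pfun \<gamma> (Inf K))
          - g (pfun \<gamma> s) * (pfun \<gamma> (Sup K) - pfun \<gamma> (Inf K)))
        \<le> e * (arclen \<gamma> (Sup K) - arclen \<gamma> (Inf K))"
        using tdi[OF sK] cd fine sK by (intro \<delta>(2)) auto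
      then show "norm (case (s, K) of (s, K) \<Rightarrow> f (pfun \<gamma> (Sup K)) - f (pfun \<gamma> (Inf K))
          - g (pfun \<gamma> s) * (pfun \<gamma> (Sup K) - pfun \<gamma> (Inf K)))
        \<le> e * (arclen \<gamma> (Sup K) - arclen \<gamma> (Inf K))" by simp
    qed (use cd in simp)
    also note e(2)
    finally show "norm ((\<Sum>(s, K)\<in>p. g (pfun \<sigma> s) * (pfun \<sigma> (Sup K) - pfun \<sigma> (Inf K)))
          - (f (final_pt \<sigma>) - f (initial_pt \<sigma>))) < \<epsilon>" .
  qed
qed

text \<open>
  On a short subpath \<open>g\<close> is within \<open>\<epsilon>\<close> of its value at \<open>s\<close>, so each Riemann-Stieltjes sum differs from
  \<open>g (\<gamma> s) (\<gamma> d - \<gamma> c)\<close> by at most \<open>\<epsilon>\<close> times the length, and the integral is a limit of such sums.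
\<close>

lemma integral_imp_derivative_along:
  assumes "rectifiable \<gamma>" and cont: "continuous_on (trace \<gamma>) g"
    and int: "\<And>\<sigma>. subpath_of \<sigma> \<gamma> \<Longrightarrow>
      has_path_integral g (f (final_pt \<sigma>) - f (initial_pt \<sigma>)) \<sigma>"
  shows "derivative_along \<gamma> (\<lambda>t. f (pfun \<gamma> t)) (\<lambda>t. g (pfun \<gamma> t))"
  unfolding derivative_along_def
proof (intro allI impI)
  fix \<epsilon> :: real assume "\<epsilon> > 0"
  have path: "is_path \<gamma>" using assms(1) by (simp add: rectifiable_def)
  have "continuous_on (dom \<gamma>) (\<lambda>t. g (pfun \<gamma> t))"
    using cont path by (auto simp: is_path_def trace_def intro: continuous_on_compose2)
  then obtain \<delta> where \<delta>: "\<delta> > 0" "\<And>x s. x \<in> dom \<gamma> \<Longrightarrow> s \<in> dom \<gamma> \<Longrightarrow> \<bar>x - s\<bar> < \<delta> \<Longrightarrow>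
       norm (g (pfun \<gamma> x) - g (pfun \<gamma> s)) < \<epsilon>"
    using uniform_on_dom[OF _ \<open>\<epsilon> > 0\<close>] by blast
  have "norm (f (pfun \<gamma> d) - f (pfun \<gamma> c) - g (pfun \<gamma> s) * (pfun \<gamma> d - pfun \<gamma> c))
      \<le> \<epsilon> * (arclen \<gamma> d - arclen \<gamma> c)"
    if csd: "lo \<gamma> \<le> c" "c \<le> s" "s \<le> d" "d \<le> hi \<gamma>" "d - c < \<delta>" for c s d
  proof (cases "c = d")
    case True
    then show ?thesis by simp
  next
    case False
    with csd have "c < d" by simp
    define \<sigma> where "\<sigma> = Path c d (restrict (pfun \<gamma>) {c..d})"
    have \<sigma>: "subpath_of \<sigma> \<gamma>" using csd \<open>c < d\<close> by (simp add: subpath_of_def \<sigma>_def dom_def)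
    have dom_\<sigma>: "dom \<sigma> = {c..d}" by (simp add: \<sigma>_def dom_def)
    have ends: "final_pt \<sigma> = pfun \<gamma> d" "initial_pt \<sigma> = pfun \<gamma> c"
      using \<open>c < d\<close> by (auto simp: final_pt_def initial_pt_def \<sigma>_def)
    show ?thesis
    proof (rule field_le_epsilon)
      fix e :: real assume "e > 0"
      then obtain \<delta>' where \<delta>': "\<delta>' > 0"
        "\<And>p. p tagged_division_of {c..d} \<Longrightarrow> (\<And>s K. (s, K) \<in> p \<Longrightarrow> Sup K - Inf K < \<delta>') \<Longrightarrow>
          norm ((\<Sum>(s, K)\<in>p. g (pfun \<sigma> s) * (pfun \<sigma> (Sup K) - pfun \<sigma> (Inf K)))
            - (f (pfun \<gamma> d) - f (pfun \<gamma> c))) < e"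
        using int[OF \<sigma>] unfolding has_path_integral_def ends dom_\<sigma> by fast
      obtain p where p: "p tagged_division_of {c..d}"
          "\<And>s K. (s, K) \<in> p \<Longrightarrow> Sup K - Inf K < \<delta>'"
        using fine_tagged_division[OF \<delta>'(1)] by blast
      note tdi = tagged_division_interval[OF p(1)]
      let ?S = "\<Sum>(s, K)\<in>p. g (pfun \<gamma> s) * (pfun \<gamma> (Sup K) - pfun \<gamma> (Inf K))"
      have "(\<Sum>(s, K)\<in>p. g (pfun \<sigma> s) * (pfun \<sigma> (Sup K) - pfun \<sigma> (Inf K))) = ?S"
      proof (intro sum.cong refl, clarify)
        fix s K assume "(s, K) \<in> p"
        from tdi[OF this] show "g (pfun \<sigma> s) * (pfun \<sigma> (Sup K) - pfun \<sigma> (Inf K)) =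
            g (pfun \<gamma> s) * (pfun \<gamma> (Sup K) - pfun \<gamma> (Inf K))"
          by (simp add: \<sigma>_def)
      qed
      with \<delta>'(2)[OF p] have 1: "norm (?S - (f (pfun \<gamma> d) - f (pfun \<gamma> c))) < e" by simp
      have "?S - g (pfun \<gamma> s) * (pfun \<gamma> d - pfun \<gamma> c) =
          ?S - g (pfun \<gamma> s) * (\<Sum>(s, K)\<in>p. pfun \<gamma> (Sup K) - pfun \<gamma> (Inf K))"
        using additive_tagged_division_1[OF _ p(1), of "pfun \<gamma>"] \<open>c < d\<close> by simp
      also have "\<dots> = (\<Sum>(x, K)\<in>p. (g (pfun \<gamma> x) - g (pfun \<gamma> s)) *
          (pfun \<gamma> (Sup K) - pfun \<gamma> (Inf K)))"
        unfolding sum_distrib_left sum_subtractf[symmetric]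
        by (intro sum.cong) (auto simp: left_diff_distrib)
      finally have 2: "norm (?S - g (pfun \<gamma> s) * (pfun \<gamma> d - pfun \<gamma> c)) =
          norm (\<Sum>(x, K)\<in>p. (g (pfun \<gamma> x) - g (pfun \<gamma> s)) *
            (pfun \<gamma> (Sup K) - pfun \<gamma> (Inf K)))" by simp
      have 3: "\<dots> \<le> \<epsilon> * (arclen \<gamma> d - arclen \<gamma> c)"
      proof (rule sum_tagged_le[OF p(1)])
        fix x K assume xK: "(x, K) \<in> p"
        have "norm (g (pfun \<gamma> x) - g (pfun \<gamma> s)) \<le> \<epsilon>"
          using tdi[OF xK] csd by (intro less_imp_le \<delta>(2)) (auto simp: dom_def)
        moreover have "norm (pfun \<gamma> (Sup K) - pfun \<gamma> (Inf K)) \<le> arclen \<gamma> (Sup K) - arclen \<gamma> (Inf K)"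
          using tdi[OF xK] csd by (intro norm_le_arclen assms(1)) auto
        ultimately show "norm (case (x, K) of (x, K) \<Rightarrow> (g (pfun \<gamma> x) - g (pfun \<gamma> s)) *
            (pfun \<gamma> (Sup K) - pfun \<gamma> (Inf K))) \<le> \<epsilon> * (arclen \<gamma> (Sup K) - arclen \<gamma> (Inf K))"
          using \<open>\<epsilon> > 0\<close> by (auto simp: norm_mult intro!: mult_mono)
      qed (use \<open>c < d\<close> in simp)
      have "norm (f (pfun \<gamma> d) - f (pfun \<gamma> c) - g (pfun \<gamma> s) * (pfun \<gamma> d - pfun \<gamma> c)) =
          norm ((?S - g (pfun \<gamma> s) * (pfun \<gamma> d - pfun \<gamma> c)) - (?S - (f (pfun \<gamma> d) - f (pfun \<gamma> c))))"
        by (simp add: algebra_simps)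
      also have "\<dots> \<le> norm (?S - g (pfun \<gamma> s) * (pfun \<gamma> d - pfun \<gamma> c))
          + norm (?S - (f (pfun \<gamma> d) - f (pfun \<gamma> c)))"
        by (rule norm_triangle_ineq4)
      also have "\<dots> \<le> \<epsilon> * (arclen \<gamma> d - arclen \<gamma> c) + e"
        using 1 2 3 by linarith
      finally show "norm (f (pfun \<gamma> d) - f (pfun \<gamma> c) - g (pfun \<gamma> s) * (pfun \<gamma> d - pfun \<gamma> c))
          \<le> \<epsilon> * (arclen \<gamma> d - arclen \<gamma> c) + e" .
    qed
  qed
  with \<delta>(1) show "\<exists>\<delta>>0. \<forall>c s d. lo \<gamma> \<le> c \<and> c \<le> s \<and> s \<le> d \<and> d \<le> hi \<gamma> \<and> d - c < \<delta> \<longrightarrow>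
        norm (f (pfun \<gamma> d) - f (pfun \<gamma> c) - g (pfun \<gamma> s) * (pfun \<gamma> d - pfun \<gamma> c))
          \<le> \<epsilon> * (arclen \<gamma> d - arclen \<gamma> c)" by blast
qed

text \<open>
  If the derivatives differ at \<open>t\<close>, subtracting the two conditions shows that on a small interval
  around \<open>t\<close> each chord is at most half of its arc.  Then half of the arc length also dominates
  the chords, so by minimality the interval has length 0 and the path is constant there.
\<close>

lemma derivative_along_unique:
  assumes adm: "admissible \<gamma>"
    and G1: "derivative_along \<gamma> F G1" "continuous_on (dom \<gamma>) G1"
    and G2: "derivative_along \<gamma> F G2" "continuous_on (dom \<gamma>) G2"
    and t: "t \<in> dom \<gamma>"
  shows "G1 t = G2 t"
proof (rule ccontr)
  assume "G1 t \<noteq> G2 t"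
  define H where "H x = G1 x - G2 x" for x
  define m where "m = norm (H t)"
  have "m > 0" using \<open>G1 t \<noteq> G2 t\<close> by (simp add: m_def H_def)
  have rect: "rectifiable \<gamma>" using adm by (simp add: admissible_def)
  have "continuous_on (dom \<gamma>) H"
    unfolding H_def by (intro continuous_on_diff G1 G2)
  then obtain \<delta>0 where \<delta>0: "\<delta>0 > 0" "\<forall>x\<in>dom \<gamma>. dist x t < \<delta>0 \<longrightarrow> dist (H x) (H t) < m / 2"
    using t \<open>m > 0\<close> unfolding continuous_on_iff by (meson half_gt_zero)
  have large: "m / 2 \<le> norm (H x)" if "x \<in> dom \<gamma>" "\<bar>x - t\<bar> < \<delta>0" for x
  proof -
    have "norm (H x - H t) < m / 2" using \<delta>0(2) that by (simp add: dist_norm)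
    moreover have "m \<le> norm (H x) + norm (H x - H t)"
      unfolding m_def by (metis norm_triangle_sub norm_minus_commute)
    ultimately show ?thesis by simp
  qed
  have "m / 8 > 0" using \<open>m > 0\<close> by simp
  obtain \<delta>1 where \<delta>1: "\<delta>1 > 0"
    "\<And>c s d. lo \<gamma> \<le> c \<Longrightarrow> c \<le> s \<Longrightarrow> s \<le> d \<Longrightarrow> d \<le> hi \<gamma> \<Longrightarrow> d - c < \<delta>1 \<Longrightarrow>
        norm (F d - F c - G1 s * (pfun \<gamma> d - pfun \<gamma> c)) \<le> m / 8 * (arclen \<gamma> d - arclen \<gamma> c)"
    using derivative_alongD[OF G1(1) \<open>m / 8 > 0\<close>] by blast
  obtain \<delta>2 where \<delta>2: "\<delta>2 > 0"
    "\<And>c s d. lo \<gamma> \<le> c \<Longrightarrow> c \<le> s \<Longrightarrow> s \<le> d \<Longrightarrow> d \<le> hi \<gamma> \<Longrightarrow> d - c < \<delta>2 \<Longrightarrow>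
        norm (F d - F c - G2 s * (pfun \<gamma> d - pfun \<gamma> c)) \<le> m / 8 * (arclen \<gamma> d - arclen \<gamma> c)"
    using derivative_alongD[OF G2(1) \<open>m / 8 > 0\<close>] by blast
  \<comment> \<open>The interval from \<open>t - r\<close> to \<open>t + r\<close>, cut off at the ends of the parameter interval, is
      shorter than each of the three bounds.\<close>
  define r where "r = Min {\<delta>0, \<delta>1, \<delta>2} / 3"
  have r: "r > 0" "2 * r < \<delta>0" "2 * r < \<delta>1" "2 * r < \<delta>2"
    using \<delta>0(1) \<delta>1(1) \<delta>2(1) by (auto simp: r_def)
  define a where "a = max (lo \<gamma>) (t - r)"
  define b where "b = min (hi \<gamma>) (t + r)"
  have "lo \<gamma> < hi \<gamma>" using rect by (simp add: rectifiable_def is_path_def)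
  then have ab: "lo \<gamma> \<le> a" "a < b" "b \<le> hi \<gamma>" "t - r \<le> a" "b \<le> t + r"
    using t r(1) by (auto simp: a_def b_def dom_def)
  have half: "norm (pfun \<gamma> d - pfun \<gamma> c) \<le> arclen \<gamma> d / 2 - arclen \<gamma> c / 2"
    if cd: "a \<le> c" "c \<le> d" "d \<le> b" for c d
  proof -
    let ?\<Delta> = "pfun \<gamma> d - pfun \<gamma> c"
    have "m / 2 * norm ?\<Delta> \<le> norm (H c) * norm ?\<Delta>"
      using cd ab r by (intro mult_right_mono large) (auto simp: dom_def)
    also have "\<dots> = norm ((F d - F c - G2 c * ?\<Delta>) - (F d - F c - G1 c * ?\<Delta>))"
      by (simp add: H_def norm_mult[symmetric] algebra_simps)
    also have "\<dots> \<le> norm (F d - F c - G2 c * ?\<Delta>) + norm (F d - F c - G1 c * ?\<Delta>)"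
      by (rule norm_triangle_ineq4)
    also have "\<dots> \<le> m / 8 * (arclen \<gamma> d - arclen \<gamma> c) + m / 8 * (arclen \<gamma> d - arclen \<gamma> c)"
      using cd ab r by (intro add_mono \<delta>1(2) \<delta>2(2)) auto
    finally have "m / 2 * norm ?\<Delta> \<le> m / 2 * (arclen \<gamma> d / 2 - arclen \<gamma> c / 2)"
      by (simp add: algebra_simps)
    then show ?thesis using \<open>m > 0\<close> by simp
  qed
  have "arclen \<gamma> b - arclen \<gamma> a \<le> arclen \<gamma> b / 2 - arclen \<gamma> a / 2"
    by (rule arclen_least[OF rect, where W = "\<lambda>t. arclen \<gamma> t / 2"]) (use ab half in auto)
  then have flat: "arclen \<gamma> b \<le> arclen \<gamma> a" by simp
  define \<sigma> where "\<sigma> = Path a b (restrict (pfun \<gamma>) {a..b})"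
  have "pfun \<sigma> x = pfun \<gamma> a" if x: "x \<in> dom \<sigma>" for x
  proof -
    have x': "a \<le> x" "x \<le> b" using x by (auto simp: \<sigma>_def dom_def)
    have "norm (pfun \<gamma> x - pfun \<gamma> a) \<le> arclen \<gamma> x - arclen \<gamma> a"
      using x' ab by (intro norm_le_arclen rect) auto
    also have "\<dots> \<le> 0" using arclen_mono[OF rect, of x b] x' ab flat by simp
    finally show ?thesis using x' by (simp add: \<sigma>_def)
  qed
  then have "constant_path \<sigma>" unfolding constant_path_def constant_on_def by blast
  moreover have "subpath_of \<sigma> \<gamma>" using ab by (simp add: subpath_of_def \<sigma>_def dom_def)
  ultimately show False using adm by (simp add: admissible_def)
qed

text \<open>
  The condition bounds increments over short intervals; a fine division extends the bound
  to all intervals.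
\<close>

lemma derivative_along_lipschitz:
  assumes rect: "rectifiable \<gamma>" and along: "derivative_along \<gamma> F G"
    and cont: "continuous_on (dom \<gamma>) G"
  obtains M where "M \<ge> 0" "\<And>c d. lo \<gamma> \<le> c \<Longrightarrow> c \<le> d \<Longrightarrow> d \<le> hi \<gamma> \<Longrightarrow>
    norm (F d - F c) \<le> M * (arclen \<gamma> d - arclen \<gamma> c)"
proof -
  obtain B where B: "B \<ge> 0" "\<And>t. t \<in> dom \<gamma> \<Longrightarrow> norm (G t) \<le> B"
    using bounded_on_dom[OF cont] by blast
  obtain \<delta> where \<delta>: "\<delta> > 0"
    "\<And>c s d. lo \<gamma> \<le> c \<Longrightarrow> c \<le> s \<Longrightarrow> s \<le> d \<Longrightarrow> d \<le> hi \<gamma> \<Longrightarrow> d - c < \<delta> \<Longrightarrow>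
        norm (F d - F c - G s * (pfun \<gamma> d - pfun \<gamma> c)) \<le> 1 * (arclen \<gamma> d - arclen \<gamma> c)"
    using derivative_alongD[OF along zero_less_one] by blast
  have "norm (F d - F c) \<le> (1 + B) * (arclen \<gamma> d - arclen \<gamma> c)"
    if cd: "lo \<gamma> \<le> c" "c \<le> d" "d \<le> hi \<gamma>" for c d
  proof -
    obtain p where p: "p tagged_division_of {c..d}" "\<And>s K. (s, K) \<in> p \<Longrightarrow> Sup K - Inf K < \<delta>"
      using fine_tagged_division[OF \<delta>(1)] by blast
    have "norm (\<Sum>(s, K)\<in>p. F (Sup K) - F (Inf K)) \<le> (1 + B) * (arclen \<gamma> d - arclen \<gamma> c)"
    proof (rule sum_tagged_le[OF p(1) cd(2)])
      fix s K assume sK: "(s, K) \<in> p"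
      let ?c = "Inf K" and ?d = "Sup K"
      have K: "lo \<gamma> \<le> ?c" "?c \<le> s" "s \<le> ?d" "?d \<le> hi \<gamma>"
        using tagged_division_interval[OF p(1) sK] cd by auto
      have "norm (F ?d - F ?c) =
          norm ((F ?d - F ?c - G s * (pfun \<gamma> ?d - pfun \<gamma> ?c)) + G s * (pfun \<gamma> ?d - pfun \<gamma> ?c))"
        by simp
      also have "\<dots> \<le> norm (F ?d - F ?c - G s * (pfun \<gamma> ?d - pfun \<gamma> ?c))
          + norm (G s) * norm (pfun \<gamma> ?d - pfun \<gamma> ?c)"
        by (metis norm_triangle_ineq norm_mult)
      also have "\<dots> \<le> 1 * (arclen \<gamma> ?d - arclen \<gamma> ?c) + B * (arclen \<gamma> ?d - arclen \<gamma> ?c)"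
        using K p(2)[OF sK] B
        by (intro add_mono \<delta>(2) mult_mono norm_le_arclen rect B) (auto simp: dom_def)
      also have "\<dots> = (1 + B) * (arclen \<gamma> ?d - arclen \<gamma> ?c)" by (simp add: algebra_simps)
      finally show "norm (case (s, K) of (s, K) \<Rightarrow> F (Sup K) - F (Inf K))
          \<le> (1 + B) * (arclen \<gamma> (Sup K) - arclen \<gamma> (Inf K))" by simp
    qed
    with additive_tagged_division_1[OF cd(2) p(1), of F] show ?thesis by simp
  qed
  with B(1) show thesis by (intro that[of "1 + B"]) auto
qed

lemma derivative_along_add:
  assumes "derivative_along \<gamma> F F'" "derivative_along \<gamma> G G'"
  shows "derivative_along \<gamma> (\<lambda>t. F t + G t) (\<lambda>t. F' t + G' t)"
  unfolding derivative_along_def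
proof (intro allI impI)
  fix \<epsilon> :: real assume "\<epsilon> > 0"
  then have "\<epsilon> / 2 > 0" by simp
  obtain \<delta>1 where \<delta>1: "\<delta>1 > 0"
    "\<And>c s d. lo \<gamma> \<le> c \<Longrightarrow> c \<le> s \<Longrightarrow> s \<le> d \<Longrightarrow> d \<le> hi \<gamma> \<Longrightarrow> d - c < \<delta>1 \<Longrightarrow>
        norm (F d - F c - F' s * (pfun \<gamma> d - pfun \<gamma> c)) \<le> \<epsilon> / 2 * (arclen \<gamma> d - arclen \<gamma> c)"
    using derivative_alongD[OF assms(1) \<open>\<epsilon> / 2 > 0\<close>] by blast
  obtain \<delta>2 where \<delta>2: "\<delta>2 > 0"
    "\<And>c s d. lo \<gamma> \<le> c \<Longrightarrow> c \<le> s \<Longrightarrow> s \<le> d \<Longrightarrow> d \<le> hi \<gamma> \<Longrightarrow> d - c < \<delta>2 \<Longrightarrow>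
        norm (G d - G c - G' s * (pfun \<gamma> d - pfun \<gamma> c)) \<le> \<epsilon> / 2 * (arclen \<gamma> d - arclen \<gamma> c)"
    using derivative_alongD[OF assms(2) \<open>\<epsilon> / 2 > 0\<close>] by blast
  have "norm (F d + G d - (F c + G c) - (F' s + G' s) * (pfun \<gamma> d - pfun \<gamma> c))
      \<le> \<epsilon> * (arclen \<gamma> d - arclen \<gamma> c)"
    if csd: "lo \<gamma> \<le> c" "c \<le> s" "s \<le> d" "d \<le> hi \<gamma>" "d - c < min \<delta>1 \<delta>2" for c s d
  proof -
    let ?\<Delta> = "pfun \<gamma> d - pfun \<gamma> c"
    have "norm (F d + G d - (F c + G c) - (F' s + G' s) * ?\<Delta>) =
        norm ((F d - F c - F' s * ?\<Delta>) + (G d - G c - G' s * ?\<Delta>))"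
      by (simp add: algebra_simps)
    also have "\<dots> \<le> norm (F d - F c - F' s * ?\<Delta>) + norm (G d - G c - G' s * ?\<Delta>)"
      by (rule norm_triangle_ineq)
    also have "\<dots> \<le> \<epsilon> / 2 * (arclen \<gamma> d - arclen \<gamma> c) + \<epsilon> / 2 * (arclen \<gamma> d - arclen \<gamma> c)"
      using csd by (intro add_mono \<delta>1(2) \<delta>2(2)) auto
    also have "\<dots> = \<epsilon> * (arclen \<gamma> d - arclen \<gamma> c)" by simp
    finally show ?thesis .
  qed
  with \<delta>1(1) \<delta>2(1) show "\<exists>\<delta>>0. \<forall>c s d. lo \<gamma> \<le> c \<and> c \<le> s \<and> s \<le> d \<and> d \<le> hi \<gamma> \<and> d - c < \<delta> \<longrightarrow>
      norm (F d + G d - (F c + G c) - (F' s + G' s) * (pfun \<gamma> d - pfun \<gamma> c))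
        \<le> \<epsilon> * (arclen \<gamma> d - arclen \<gamma> c)"
    by (intro exI[of _ "min \<delta>1 \<delta>2"]) auto
qed

text \<open>
  Apart from the errors of the two factors there are products of two increments; one of them is
  small by uniform continuity, the other is bounded by a multiple of the arc length.
\<close>

lemma derivative_along_mult:
  assumes rect: "rectifiable \<gamma>"
    and F: "derivative_along \<gamma> F F'" "continuous_on (dom \<gamma>) F" "continuous_on (dom \<gamma>) F'"
    and G: "derivative_along \<gamma> G G'" "continuous_on (dom \<gamma>) G" "continuous_on (dom \<gamma>) G'"
  shows "derivative_along \<gamma> (\<lambda>t. F t * G t) (\<lambda>t. F' t * G t + F t * G' t)"
  unfolding derivative_along_def
proof (intro allI impI)
  fix \<epsilon> :: real assume "\<epsilon> > 0"
  obtain A where A: "A \<ge> 0" "\<And>t. t \<in> dom \<gamma> \<Longrightarrow> norm (F t) \<le> A"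
    using bounded_on_dom[OF F(2)] by blast
  obtain B where B: "B \<ge> 0" "\<And>t. t \<in> dom \<gamma> \<Longrightarrow> norm (G t) \<le> B"
    using bounded_on_dom[OF G(2)] by blast
  obtain M where M: "M \<ge> 0" "\<And>c d. lo \<gamma> \<le> c \<Longrightarrow> c \<le> d \<Longrightarrow> d \<le> hi \<gamma> \<Longrightarrow>
      norm (F d - F c) \<le> M * (arclen \<gamma> d - arclen \<gamma> c)"
    using derivative_along_lipschitz[OF rect F(1,3)] by blast
  obtain N where N: "N \<ge> 0" "\<And>c d. lo \<gamma> \<le> c \<Longrightarrow> c \<le> d \<Longrightarrow> d \<le> hi \<gamma> \<Longrightarrow>
      norm (G d - G c) \<le> N * (arclen \<gamma> d - arclen \<gamma> c)"
    using derivative_along_lipschitz[OF rect G(1,3)] by blast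
  define e where "e = \<epsilon> / (A + B + M + N + 1)"
  have e: "e > 0" "e * (A + B + M + N) \<le> \<epsilon>"
    using \<open>\<epsilon> > 0\<close> A(1) B(1) M(1) N(1) by (auto simp: e_def field_simps)
  obtain \<delta>1 where \<delta>1: "\<delta>1 > 0"
    "\<And>c s d. lo \<gamma> \<le> c \<Longrightarrow> c \<le> s \<Longrightarrow> s \<le> d \<Longrightarrow> d \<le> hi \<gamma> \<Longrightarrow> d - c < \<delta>1 \<Longrightarrow>
        norm (F d - F c - F' s * (pfun \<gamma> d - pfun \<gamma> c)) \<le> e * (arclen \<gamma> d - arclen \<gamma> c)"
    using derivative_alongD[OF F(1) e(1)] by blast
  obtain \<delta>2 where \<delta>2: "\<delta>2 > 0"
    "\<And>c s d. lo \<gamma> \<le> c \<Longrightarrow> c \<le> s \<Longrightarrow> s \<le> d \<Longrightarrow> d \<le> hi \<gamma> \<Longrightarrow> d - c < \<delta>2 \<Longrightarrow>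
        norm (G d - G c - G' s * (pfun \<gamma> d - pfun \<gamma> c)) \<le> e * (arclen \<gamma> d - arclen \<gamma> c)"
    using derivative_alongD[OF G(1) e(1)] by blast
  obtain \<delta>3 where \<delta>3: "\<delta>3 > 0"
    "\<And>x s. x \<in> dom \<gamma> \<Longrightarrow> s \<in> dom \<gamma> \<Longrightarrow> \<bar>x - s\<bar> < \<delta>3 \<Longrightarrow> norm (F x - F s) < e"
    using uniform_on_dom[OF F(2) e(1)] by blast
  obtain \<delta>4 where \<delta>4: "\<delta>4 > 0"
    "\<And>x s. x \<in> dom \<gamma> \<Longrightarrow> s \<in> dom \<gamma> \<Longrightarrow> \<bar>x - s\<bar> < \<delta>4 \<Longrightarrow> norm (G x - G s) < e"
    using uniform_on_dom[OF G(2) e(1)] by blast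
  define \<delta> where "\<delta> = min (min \<delta>1 \<delta>2) (min \<delta>3 \<delta>4)"
  have "norm (F d * G d - F c * G c - (F' s * G s + F s * G' s) * (pfun \<gamma> d - pfun \<gamma> c))
      \<le> \<epsilon> * (arclen \<gamma> d - arclen \<gamma> c)"
    if csd: "lo \<gamma> \<le> c" "c \<le> s" "s \<le> d" "d \<le> hi \<gamma>" "d - c < \<delta>" for c s d
  proof -
    let ?\<Delta> = "pfun \<gamma> d - pfun \<gamma> c" and ?L = "arclen \<gamma> d - arclen \<gamma> c"
    have L: "?L \<ge> 0" using arclen_mono[OF rect, of c d] csd by simp
    have \<delta>: "d - c < \<delta>1" "d - c < \<delta>2" "d - c < \<delta>3" "d - c < \<delta>4"
      using csd(5) by (auto simp: \<delta>_def)
    have in_dom: "c \<in> dom \<gamma>" "s \<in> dom \<gamma>" "d \<in> dom \<gamma>" using csd by (auto simp: dom_def)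
    have 1: "norm ((F d - F c - F' s * ?\<Delta>) * G s) \<le> (e * ?L) * B"
      unfolding norm_mult using csd \<delta> L e in_dom by (intro mult_mono \<delta>1(2) B) auto
    have 2: "norm (F s * (G d - G c - G' s * ?\<Delta>)) \<le> A * (e * ?L)"
      unfolding norm_mult using csd \<delta> L e in_dom A(1) by (intro mult_mono \<delta>2(2) A) auto
    have 3: "norm ((F d - F s) * (G d - G c)) \<le> e * (N * ?L)"
      unfolding norm_mult using csd \<delta> L e in_dom
      by (intro mult_mono N less_imp_le[OF \<delta>3(2)]) auto
    have 4: "norm ((F d - F c) * (G c - G s)) \<le> (M * ?L) * e"
      unfolding norm_mult using csd \<delta> L e in_dom M(1)
      by (intro mult_mono M less_imp_le[OF \<delta>4(2)]) auto
    have "F d * G d - F c * G c - (F' s * G s + F s * G' s) * ?\<Delta> =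
        (F d - F c - F' s * ?\<Delta>) * G s + F s * (G d - G c - G' s * ?\<Delta>)
        + (F d - F s) * (G d - G c) + (F d - F c) * (G c - G s)"
      by (simp add: algebra_simps)
    also have "norm \<dots> \<le> (e * ?L) * B + A * (e * ?L) + e * (N * ?L) + (M * ?L) * e"
      by (intro norm_triangle_mono 1 2 3 4)
    also have "\<dots> = (e * (A + B + M + N)) * ?L" by (simp add: algebra_simps)
    also have "\<dots> \<le> \<epsilon> * ?L" using e(2) L by (rule mult_right_mono)
    finally show ?thesis .
  qed
  moreover have "\<delta> > 0" using \<delta>1(1) \<delta>2(1) \<delta>3(1) \<delta>4(1) by (simp add: \<delta>_def)
  ultimately show "\<exists>\<delta>>0. \<forall>c s d. lo \<gamma> \<le> c \<and> c \<le> s \<and> s \<le> d \<and> d \<le> hi \<gamma> \<and> d - c < \<delta> \<longrightarrow>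
      norm (F d * G d - F c * G c - (F' s * G s + F s * G' s) * (pfun \<gamma> d - pfun \<gamma> c))
        \<le> \<epsilon> * (arclen \<gamma> d - arclen \<gamma> c)"
    by blast
qed

text \<open>
  The error of \<open>F\<close> is measured by the arc length of \<open>\<psi>\<close>.  It is small relative to the arc length of
  \<open>\<gamma>\<close> because \<open>\<psi>\<close> is Lipschitz with respect to the latter.
\<close>

lemma derivative_along_chain:
  assumes rect: "rectifiable \<gamma>" "rectifiable \<psi>" and same: "lo \<psi> = lo \<gamma>" "hi \<psi> = hi \<gamma>"
    and P: "derivative_along \<gamma> (pfun \<psi>) P" "continuous_on (dom \<gamma>) P"
    and Q: "derivative_along \<psi> F Q" "continuous_on (dom \<gamma>) Q"
  shows "derivative_along \<gamma> F (\<lambda>t. Q t * P t)"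
  unfolding derivative_along_def
proof (intro allI impI)
  fix \<epsilon> :: real assume "\<epsilon> > 0"
  obtain B where B: "B \<ge> 0" "\<And>t. t \<in> dom \<gamma> \<Longrightarrow> norm (Q t) \<le> B"
    using bounded_on_dom[OF Q(2)] by blast
  obtain M where M: "M \<ge> 0" "\<And>c d. lo \<gamma> \<le> c \<Longrightarrow> c \<le> d \<Longrightarrow> d \<le> hi \<gamma> \<Longrightarrow>
      norm (pfun \<psi> d - pfun \<psi> c) \<le> M * (arclen \<gamma> d - arclen \<gamma> c)"
    using derivative_along_lipschitz[OF rect(1) P] by blast
  have arc: "arclen \<psi> d - arclen \<psi> c \<le> M * (arclen \<gamma> d - arclen \<gamma> c)"
    if "lo \<gamma> \<le> c" "c \<le> d" "d \<le> hi \<gamma>" for c d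
  proof -
    have "arclen \<psi> d - arclen \<psi> c \<le> M * arclen \<gamma> d - M * arclen \<gamma> c"
    proof (rule arclen_least[OF rect(2), where W = "\<lambda>t. M * arclen \<gamma> t"])
      show "norm (pfun \<psi> y - pfun \<psi> x) \<le> M * arclen \<gamma> y - M * arclen \<gamma> x"
        if "c \<le> x" "x \<le> y" "y \<le> d" for x y
        using M(2)[of x y] that \<open>lo \<gamma> \<le> c\<close> \<open>d \<le> hi \<gamma>\<close> by (simp add: right_diff_distrib)
    qed (use that same in simp_all)
    then show ?thesis by (simp add: right_diff_distrib)
  qed
  define e where "e = \<epsilon> / (M + B + 1)"
  have e: "e > 0" "e * (M + B) \<le> \<epsilon>"
    using \<open>\<epsilon> > 0\<close> B(1) M(1) by (auto simp: e_def field_simps)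
  obtain \<delta>1 where \<delta>1: "\<delta>1 > 0"
    "\<And>c s d. lo \<gamma> \<le> c \<Longrightarrow> c \<le> s \<Longrightarrow> s \<le> d \<Longrightarrow> d \<le> hi \<gamma> \<Longrightarrow> d - c < \<delta>1 \<Longrightarrow>
        norm (pfun \<psi> d - pfun \<psi> c - P s * (pfun \<gamma> d - pfun \<gamma> c))
          \<le> e * (arclen \<gamma> d - arclen \<gamma> c)"
    using derivative_alongD[OF P(1) e(1)] by blast
  obtain \<delta>2 where \<delta>2: "\<delta>2 > 0"
    "\<And>c s d. lo \<gamma> \<le> c \<Longrightarrow> c \<le> s \<Longrightarrow> s \<le> d \<Longrightarrow> d \<le> hi \<gamma> \<Longrightarrow> d - c < \<delta>2 \<Longrightarrow>
        norm (F d - F c - Q s * (pfun \<psi> d - pfun \<psi> c)) \<le> e * (arclen \<psi> d - arclen \<psi> c)"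
    using derivative_alongD[OF Q(1) e(1)] unfolding same by blast
  have "norm (F d - F c - (Q s * P s) * (pfun \<gamma> d - pfun \<gamma> c))
      \<le> \<epsilon> * (arclen \<gamma> d - arclen \<gamma> c)"
    if csd: "lo \<gamma> \<le> c" "c \<le> s" "s \<le> d" "d \<le> hi \<gamma>" "d - c < min \<delta>1 \<delta>2" for c s d
  proof -
    let ?\<Delta> = "pfun \<gamma> d - pfun \<gamma> c" and ?L = "arclen \<gamma> d - arclen \<gamma> c"
    have L: "?L \<ge> 0" using arclen_mono[OF rect(1), of c d] csd by simp
    have "norm (F d - F c - Q s * (pfun \<psi> d - pfun \<psi> c)) \<le> e * (arclen \<psi> d - arclen \<psi> c)"
      using csd by (intro \<delta>2(2)) auto
    also have "\<dots> \<le> e * (M * ?L)" using arc[of c d] csd e(1) by (intro mult_left_mono) auto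
    finally have 1: "norm (F d - F c - Q s * (pfun \<psi> d - pfun \<psi> c)) \<le> e * (M * ?L)" .
    have 2: "norm (Q s * (pfun \<psi> d - pfun \<psi> c - P s * ?\<Delta>)) \<le> B * (e * ?L)"
      unfolding norm_mult using csd B(1) by (intro mult_mono \<delta>1(2) B) (auto simp: dom_def)
    have "F d - F c - (Q s * P s) * ?\<Delta> =
        (F d - F c - Q s * (pfun \<psi> d - pfun \<psi> c)) + Q s * (pfun \<psi> d - pfun \<psi> c - P s * ?\<Delta>)"
      by (simp add: algebra_simps)
    also have "norm \<dots> \<le> e * (M * ?L) + B * (e * ?L)"
      by (intro norm_triangle_mono 1 2)
    also have "\<dots> = (e * (M + B)) * ?L" by (simp add: algebra_simps)
    also have "\<dots> \<le> \<epsilon> * ?L" using e(2) L by (rule mult_right_mono)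
    finally show ?thesis .
  qed
  with \<delta>1(1) \<delta>2(1) show "\<exists>\<delta>>0. \<forall>c s d. lo \<gamma> \<le> c \<and> c \<le> s \<and> s \<le> d \<and> d \<le> hi \<gamma> \<and> d - c < \<delta> \<longrightarrow>
      norm (F d - F c - (Q s * P s) * (pfun \<gamma> d - pfun \<gamma> c)) \<le> \<epsilon> * (arclen \<gamma> d - arclen \<gamma> c)"
    by (intro exI[of _ "min \<delta>1 \<delta>2"]) auto
qed

text \<open>
  The case of the chain rule in which the path length parametrisation does not exist.
\<close>

lemma derivative_along_constant_path:
  assumes "rectifiable \<psi>" "constant_path \<psi>"
  shows "derivative_along \<psi> (\<lambda>t. f (pfun \<psi> t)) G"
  unfolding derivative_along_def
proof (intro allI impI exI[of _ 1] conjI zero_less_one, elim conjE)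
  fix \<epsilon> c s d :: real
  assume "\<epsilon> > 0" and csd: "lo \<psi> \<le> c" "c \<le> s" "s \<le> d" "d \<le> hi \<psi>"
  have "pfun \<psi> d = pfun \<psi> c"
    using assms(2) csd unfolding constant_path_def constant_on_def by (auto simp: dom_def)
  moreover have "arclen \<psi> c \<le> arclen \<psi> d" using csd by (intro arclen_mono assms(1)) auto
  ultimately show "norm (f (pfun \<psi> d) - f (pfun \<psi> c) - G s * (pfun \<psi> d - pfun \<psi> c))
      \<le> \<epsilon> * (arclen \<psi> d - arclen \<psi> c)"
    using \<open>\<epsilon> > 0\<close> by simp
qed

section \<open>The path length parametrisation\<close>

lemma arclen_surj:
  assumes "rectifiable \<gamma>" "u \<in> {0..path_len \<gamma>}"
  obtains t where "t \<in> dom \<gamma>" "arclen \<gamma> t = u"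
proof -
  have "lo \<gamma> \<le> hi \<gamma>" using assms(1) by (simp add: rectifiable_def is_path_def)
  moreover have "continuous_on {lo \<gamma>..hi \<gamma>} (arclen \<gamma>)"
    using continuous_on_arclen[OF assms(1)] by (simp add: dom_def)
  ultimately obtain t where "lo \<gamma> \<le> t" "t \<le> hi \<gamma>" "arclen \<gamma> t = u"
    using IVT'[of "arclen \<gamma>" "lo \<gamma>" u "hi \<gamma>"] assms(2) by (auto simp: arclen_lo path_len_def)
  then show thesis by (intro that[of t]) (auto simp: dom_def)
qed

lemma arclen_in:
  assumes "rectifiable \<gamma>" "t \<in> dom \<gamma>"
  shows "arclen \<gamma> t \<in> {0..path_len \<gamma>}"
  using arclen_mono[OF assms(1), of "lo \<gamma>" t] arclen_mono[OF assms(1), of t "hi \<gamma>"] assms(2)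
  by (auto simp: dom_def arclen_lo path_len_def)

lemma norm_le_arclen_abs:
  assumes "rectifiable \<gamma>" "s \<in> dom \<gamma>" "t \<in> dom \<gamma>"
  shows "norm (pfun \<gamma> t - pfun \<gamma> s) \<le> \<bar>arclen \<gamma> t - arclen \<gamma> s\<bar>"
  using norm_le_arclen[OF assms(1), of s t] norm_le_arclen[OF assms(1), of t s] assms(2,3)
  by (cases "s \<le> t") (auto simp: dom_def norm_minus_commute)

text \<open>
  A parametrisation by arc length exists since the path is constant wherever arc length is, so that any
  choice \<open>\<tau>\<close> of a parameter with given arc length yields the same point; it is continuous since chords are
  bounded by arc length.  It is unique since arc length takes every value in \<open>{0..path_len \<psi>}\<close>.
\<close>

lemma path_length_param:
  assumes rect: "rectifiable \<psi>" and nonconst: "\<not> constant_path \<psi>"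
  defines "\<eta> \<equiv> path_length_param \<psi>"
  shows "is_path \<eta>" "lo \<eta> = 0" "hi \<eta> = path_len \<psi>"
    and "\<And>t. t \<in> dom \<psi> \<Longrightarrow> pfun \<eta> (arclen \<psi> t) = pfun \<psi> t"
proof -
  let ?L = "path_len \<psi>"
  let ?Q = "\<lambda>\<eta>. is_path \<eta> \<and> lo \<eta> = 0 \<and> hi \<eta> = ?L \<and>
    (\<forall>t\<in>dom \<psi>. pfun \<eta> (arclen \<psi> t) = pfun \<psi> t)"
  define \<tau> where "\<tau> u = (SOME t. t \<in> dom \<psi> \<and> arclen \<psi> t = u)" for u
  have \<tau>: "\<tau> u \<in> dom \<psi>" "arclen \<psi> (\<tau> u) = u" if "u \<in> {0..?L}" for u
  proof -
    have "\<exists>t. t \<in> dom \<psi> \<and> arclen \<psi> t = u" using arclen_surj[OF rect that] by blast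
    from someI_ex[OF this] show "\<tau> u \<in> dom \<psi>" "arclen \<psi> (\<tau> u) = u" by (auto simp: \<tau>_def)
  qed
  define \<theta> where "\<theta> = Path 0 ?L (restrict (\<lambda>u. pfun \<psi> (\<tau> u)) {0..?L})"
  have "?L \<noteq> 0"
  proof
    assume "?L = 0"
    have "pfun \<psi> t = pfun \<psi> (lo \<psi>)" if t: "t \<in> dom \<psi>" for t
    proof -
      have "lo \<psi> \<in> dom \<psi>" using t by (auto simp: dom_def)
      then show ?thesis
        using norm_le_arclen_abs[OF rect _ t, of "lo \<psi>"] arclen_in[OF rect t] \<open>?L = 0\<close>
        by (simp add: arclen_lo)
    qed
    then show False using nonconst unfolding constant_path_def constant_on_def by blast
  qed
  moreover have "?L \<ge> 0"
    using rect arclen_in[OF rect, of "lo \<psi>"]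
    by (auto simp: dom_def arclen_lo rectifiable_def is_path_def)
  ultimately have L: "?L > 0" by simp
  have lip: "norm (pfun \<psi> (\<tau> v) - pfun \<psi> (\<tau> u)) \<le> \<bar>v - u\<bar>"
    if "u \<in> {0..?L}" "v \<in> {0..?L}" for u v
    using norm_le_arclen_abs[OF rect \<tau>(1)[OF that(1)] \<tau>(1)[OF that(2)]] \<tau>(2) that by simp
  have \<theta>: "?Q \<theta>"
  proof (intro conjI ballI)
    have dom\<theta>: "dom \<theta> = {0..?L}" by (simp add: \<theta>_def dom_def)
    have "continuous_on {0..?L} (pfun \<theta>)"
      unfolding continuous_on_iff
    proof (intro ballI allI impI)
      fix u and e :: real assume "u \<in> {0..?L}" "e > 0"
      then show "\<exists>d>0. \<forall>v\<in>{0..?L}. dist v u < d \<longrightarrow> dist (pfun \<theta> v) (pfun \<theta> u) < e"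
        using lip[of u] by (intro exI[of _ e]) (force simp: \<theta>_def dist_norm)
    qed
    then show "is_path \<theta>"
      unfolding is_path_def dom\<theta> using L by (simp add: \<theta>_def)
    fix t assume t: "t \<in> dom \<psi>"
    have "norm (pfun \<psi> (\<tau> (arclen \<psi> t)) - pfun \<psi> t) \<le> 0"
      using norm_le_arclen_abs[OF rect t \<tau>(1)[OF arclen_in[OF rect t]]]
        \<tau>(2)[OF arclen_in[OF rect t]] by simp
    then show "pfun \<theta> (arclen \<psi> t) = pfun \<psi> t"
      using arclen_in[OF rect t] by (simp add: \<theta>_def)
  qed (simp_all add: \<theta>_def)
  have "?Q \<eta>"
    unfolding \<eta>_def path_length_param_def
  proof (rule theI[of ?Q \<theta>])
    show "?Q \<theta>" by (fact \<theta>)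
    fix \<zeta> assume \<zeta>: "?Q \<zeta>"
    have "pfun \<zeta> = pfun \<theta>"
    proof (rule extensionalityI[of _ "{0..?L}"])
      show "pfun \<zeta> \<in> extensional {0..?L}" "pfun \<theta> \<in> extensional {0..?L}"
        using \<zeta> \<theta> by (auto simp: is_path_def dom_def)
      fix u assume "u \<in> {0..?L}"
      then obtain t where "t \<in> dom \<psi>" "arclen \<psi> t = u" using arclen_surj[OF rect] by blast
      with \<zeta> \<theta> show "pfun \<zeta> u = pfun \<theta> u" by metis
    qed
    with \<zeta> \<theta> show "\<zeta> = \<theta>" by (intro cpath.expand) auto
  qed
  then show "is_path \<eta>" "lo \<eta> = 0" "hi \<eta> = ?L"
    "\<And>t. t \<in> dom \<psi> \<Longrightarrow> pfun \<eta> (arclen \<psi> t) = pfun \<psi> t" by blast+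
qed

text \<open>
  Parameters that are close for \<open>\<psi>\<close> have close arc lengths, by uniform continuity, and
  an arc of the parametrisation is no longer than its parameter interval.
\<close>

lemma derivative_along_from_path_length_param:
  assumes rect: "rectifiable \<psi>" and nonconst: "\<not> constant_path \<psi>"
  defines "\<eta> \<equiv> path_length_param \<psi>"
  assumes along: "derivative_along \<eta> (\<lambda>u. f (pfun \<eta> u)) (\<lambda>u. g (pfun \<eta> u))"
  shows "derivative_along \<psi> (\<lambda>t. f (pfun \<psi> t)) (\<lambda>t. g (pfun \<psi> t))"
  unfolding derivative_along_def
proof (intro allI impI)
  note \<eta> = path_length_param[OF rect nonconst, folded \<eta>_def]
  have lip: "norm (pfun \<eta> v - pfun \<eta> u) \<le> v - u" if uv: "0 \<le> u" "u \<le> v" "v \<le> path_len \<psi>" for u v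
  proof -
    have "u \<in> {0..path_len \<psi>}" "v \<in> {0..path_len \<psi>}" using uv by auto
    then obtain s t where "s \<in> dom \<psi>" "arclen \<psi> s = u" "t \<in> dom \<psi>" "arclen \<psi> t = v"
      by (meson arclen_surj[OF rect])
    then show ?thesis
      using norm_le_arclen_abs[OF rect, of s t] \<eta>(4)[of s] \<eta>(4)[of t] uv by simp
  qed
  have rect\<eta>: "rectifiable \<eta>"
    by (rule rectifiable_if_dominated[OF \<eta>(1), where W = "\<lambda>u. u"]) (use lip \<eta>(2,3) in auto)
  have arc\<eta>: "arclen \<eta> v - arclen \<eta> u \<le> v - u" if "0 \<le> u" "u \<le> v" "v \<le> path_len \<psi>" for u v
    by (rule arclen_least[OF rect\<eta>, where W = "\<lambda>u. u"]) (use that lip \<eta>(2,3) in auto)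
  fix \<epsilon> :: real assume "\<epsilon> > 0"
  obtain \<delta> where \<delta>: "\<delta> > 0"
    "\<And>c s d. lo \<eta> \<le> c \<Longrightarrow> c \<le> s \<Longrightarrow> s \<le> d \<Longrightarrow> d \<le> hi \<eta> \<Longrightarrow> d - c < \<delta> \<Longrightarrow>
        norm (f (pfun \<eta> d) - f (pfun \<eta> c) - g (pfun \<eta> s) * (pfun \<eta> d - pfun \<eta> c))
          \<le> \<epsilon> * (arclen \<eta> d - arclen \<eta> c)"
    using derivative_alongD[OF along \<open>\<epsilon> > 0\<close>] by blast
  have "continuous_on (dom \<psi>) (\<lambda>t. complex_of_real (arclen \<psi> t))"
    by (intro continuous_on_of_real continuous_on_arclen rect)
  then obtain \<delta>' where \<delta>': "\<delta>' > 0" "\<And>x s. x \<in> dom \<psi> \<Longrightarrow> s \<in> dom \<psi> \<Longrightarrow> \<bar>x - s\<bar> < \<delta>' \<Longrightarrow>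
      norm (complex_of_real (arclen \<psi> x) - complex_of_real (arclen \<psi> s)) < \<delta>"
    using uniform_on_dom[OF _ \<delta>(1)] by blast
  have "norm (f (pfun \<psi> d) - f (pfun \<psi> c) - g (pfun \<psi> s) * (pfun \<psi> d - pfun \<psi> c))
      \<le> \<epsilon> * (arclen \<psi> d - arclen \<psi> c)"
    if csd: "lo \<psi> \<le> c" "c \<le> s" "s \<le> d" "d \<le> hi \<psi>" "d - c < \<delta>'" for c s d
  proof -
    have in_dom: "c \<in> dom \<psi>" "s \<in> dom \<psi>" "d \<in> dom \<psi>" using csd by (auto simp: dom_def)
    have mono: "arclen \<psi> c \<le> arclen \<psi> s" "arclen \<psi> s \<le> arclen \<psi> d"
      using csd by (auto intro!: arclen_mono[OF rect])
    have "norm (complex_of_real (arclen \<psi> d) - complex_of_real (arclen \<psi> c)) < \<delta>"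
      using csd in_dom by (intro \<delta>'(2)) auto
    then have close: "arclen \<psi> d - arclen \<psi> c < \<delta>"
      by (simp flip: of_real_diff)
    have "norm (f (pfun \<psi> d) - f (pfun \<psi> c) - g (pfun \<psi> s) * (pfun \<psi> d - pfun \<psi> c))
        \<le> \<epsilon> * (arclen \<eta> (arclen \<psi> d) - arclen \<eta> (arclen \<psi> c))"
      using \<delta>(2)[of "arclen \<psi> c" "arclen \<psi> s" "arclen \<psi> d"] mono close
        arclen_in[OF rect in_dom(1)] arclen_in[OF rect in_dom(3)] \<eta>(2,3)
      by (simp add: \<eta>(4)[OF in_dom(1)] \<eta>(4)[OF in_dom(2)] \<eta>(4)[OF in_dom(3)])
    also have "\<dots> \<le> \<epsilon> * (arclen \<psi> d - arclen \<psi> c)"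
      using mono arclen_in[OF rect in_dom(1)] arclen_in[OF rect in_dom(3)] \<open>\<epsilon> > 0\<close>
      by (intro mult_left_mono arc\<eta>) auto
    finally show ?thesis .
  qed
  with \<delta>'(1) show "\<exists>\<delta>>0. \<forall>c s d. lo \<psi> \<le> c \<and> c \<le> s \<and> s \<le> d \<and> d \<le> hi \<psi> \<and> d - c < \<delta> \<longrightarrow>
      norm (f (pfun \<psi> d) - f (pfun \<psi> c) - g (pfun \<psi> s) * (pfun \<psi> d - pfun \<psi> c))
        \<le> \<epsilon> * (arclen \<psi> d - arclen \<psi> c)" by blast
qed

section \<open>Calculus of \<open>\<F>\<close>-derivatives\<close>

locale effective_collection =
  fixes X :: "complex set" and \<F> :: "cpath set"
  assumes compact: "compact_plane_set X" and effective: "effective X \<F>"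
begin

lemma
  assumes "\<gamma> \<in> \<F>"
  shows path_in_X: "is_path \<gamma>" "trace \<gamma> \<subseteq> X"
    and admissible: "admissible \<gamma>" and rectifiable: "rectifiable \<gamma>"
    and subpath: "subpath_of \<sigma> \<gamma> \<Longrightarrow> \<sigma> \<in> \<F>"
  using effective assms by (auto simp: effective_def path_in_def admissible_def)

lemma pfun_in_X: "\<gamma> \<in> \<F> \<Longrightarrow> t \<in> dom \<gamma> \<Longrightarrow> pfun \<gamma> t \<in> X"
  using path_in_X(2) by (auto simp: trace_def)

lemma continuous_on_path:
  assumes "\<gamma> \<in> \<F>" "continuous_on X f"
  shows "continuous_on (dom \<gamma>) (\<lambda>t. f (pfun \<gamma> t))"
  using path_in_X[OF assms(1)] assms(2)
  by (auto simp: is_path_def trace_def intro: continuous_on_compose2)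

lemma is_F_derivative_iff_along:
  "is_F_derivative X \<F> f g \<longleftrightarrow> continuous_on X f \<and> continuous_on X g \<and>
     (\<forall>\<gamma>\<in>\<F>. derivative_along \<gamma> (\<lambda>t. f (pfun \<gamma> t)) (\<lambda>t. g (pfun \<gamma> t)))"
proof (intro iffI conjI ballI)
  fix \<gamma> assume der: "is_F_derivative X \<F> f g" and \<gamma>: "\<gamma> \<in> \<F>"
  show "derivative_along \<gamma> (\<lambda>t. f (pfun \<gamma> t)) (\<lambda>t. g (pfun \<gamma> t))"
  proof (rule integral_imp_derivative_along[OF rectifiable[OF \<gamma>]])
    show "continuous_on (trace \<gamma>) g"
      using der path_in_X(2)[OF \<gamma>] by (auto simp: is_F_derivative_def intro: continuous_on_subset)
    show "has_path_integral g (f (final_pt \<sigma>) - f (initial_pt \<sigma>)) \<sigma>" if "subpath_of \<sigma> \<gamma>" for \<sigma>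
      using der subpath[OF \<gamma> that] by (simp add: is_F_derivative_def)
  qed
next
  assume along: "continuous_on X f \<and> continuous_on X g \<and>
     (\<forall>\<gamma>\<in>\<F>. derivative_along \<gamma> (\<lambda>t. f (pfun \<gamma> t)) (\<lambda>t. g (pfun \<gamma> t)))"
  show "is_F_derivative X \<F> f g"
    unfolding is_F_derivative_def
  proof (intro conjI ballI)
    fix \<gamma> assume \<gamma>: "\<gamma> \<in> \<F>"
    have "subpath_of \<gamma> \<gamma>"
      using path_in_X(1)[OF \<gamma>] by (simp add: subpath_of_def is_path_def extensional_restrict)
    with along \<gamma> show "has_path_integral g (f (final_pt \<gamma>) - f (initial_pt \<gamma>)) \<gamma>"
      by (intro derivative_along_imp_integral[OF rectifiable[OF \<gamma>]]) auto
  qed (use along in auto)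
qed (simp_all add: is_F_derivative_def)

text \<open>
  Uniqueness along the paths carries over to \<open>X\<close> because the traces are dense in \<open>X\<close>.
\<close>

lemma is_F_derivative_unique:
  assumes "is_F_derivative X \<F> f g" "is_F_derivative X \<F> f h" "z \<in> X"
  shows "g z = h z"
proof -
  let ?S = "\<Union>\<gamma>\<in>\<F>. trace \<gamma>"
  note along = assms(1,2)[unfolded is_F_derivative_iff_along]
  have "g w - h w = 0" if w: "w \<in> ?S" for w
  proof -
    obtain \<gamma> t where \<gamma>: "\<gamma> \<in> \<F>" and t: "t \<in> dom \<gamma>" "w = pfun \<gamma> t"
      using w unfolding trace_def by blast
    have "g (pfun \<gamma> t) = h (pfun \<gamma> t)"
      by (rule derivative_along_unique[OF admissible[OF \<gamma>], where F = "\<lambda>t. f (pfun \<gamma> t)"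
          and ?G1.0 = "\<lambda>t. g (pfun \<gamma> t)" and ?G2.0 = "\<lambda>t. h (pfun \<gamma> t)"])
        (use along \<gamma> t continuous_on_path in auto)
    with t show ?thesis by simp
  qed
  moreover have "?S \<subseteq> X" using path_in_X(2) by auto
  then have closure: "closure ?S = X"
    using effective compact
    by (intro antisym closure_minimal)
      (auto simp: effective_def compact_plane_set_def compact_imp_closed)
  moreover have "continuous_on X (\<lambda>w. g w - h w)"
    using along by (auto intro: continuous_on_diff)
  ultimately have "g z - h z = 0"
    using continuous_constant_on_closure[of ?S "\<lambda>w. g w - h w" 0 z] \<open>z \<in> X\<close> by auto
  then show ?thesis by simp
qed

lemma is_F_derivative_cong:
  assumes "\<And>z. z \<in> X \<Longrightarrow> f z = f' z" "\<And>z. z \<in> X \<Longrightarrow> g z = g' z"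
  shows "is_F_derivative X \<F> f g \<longleftrightarrow> is_F_derivative X \<F> f' g'"
proof -
  have "continuous_on X f \<longleftrightarrow> continuous_on X f'" "continuous_on X g \<longleftrightarrow> continuous_on X g'"
    using assms by (auto intro!: continuous_on_cong)
  moreover have "has_path_integral g (f (final_pt \<gamma>) - f (initial_pt \<gamma>)) \<gamma> \<longleftrightarrow>
      has_path_integral g' (f' (final_pt \<gamma>) - f' (initial_pt \<gamma>)) \<gamma>" if \<gamma>: "\<gamma> \<in> \<F>" for \<gamma>
  proof -
    have "lo \<gamma> \<in> dom \<gamma>" "hi \<gamma> \<in> dom \<gamma>"
      using path_in_X(1)[OF \<gamma>] by (auto simp: is_path_def dom_def)
    then have ends: "f (final_pt \<gamma>) - f (initial_pt \<gamma>) = f' (final_pt \<gamma>) - f' (initial_pt \<gamma>)"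
      using pfun_in_X[OF \<gamma>] assms(1) by (simp add: final_pt_def initial_pt_def)
    have sums: "(\<Sum>(s, K)\<in>p. g (pfun \<gamma> s) * (pfun \<gamma> (Sup K) - pfun \<gamma> (Inf K))) =
        (\<Sum>(s, K)\<in>p. g' (pfun \<gamma> s) * (pfun \<gamma> (Sup K) - pfun \<gamma> (Inf K)))"
      if "p tagged_division_of dom \<gamma>" for p
    proof (intro sum.cong refl, clarify)
      fix s K assume "(s, K) \<in> p"
      then have "pfun \<gamma> s \<in> X" by (intro pfun_in_X[OF \<gamma>] tag_in_interval[OF that])
      then show "g (pfun \<gamma> s) * (pfun \<gamma> (Sup K) - pfun \<gamma> (Inf K)) =
          g' (pfun \<gamma> s) * (pfun \<gamma> (Sup K) - pfun \<gamma> (Inf K))"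
        using assms(2) by simp
    qed
    show ?thesis unfolding has_path_integral_def ends by (simp add: sums cong: conj_cong imp_cong)
  qed
  ultimately show ?thesis unfolding is_F_derivative_def by auto
qed

lemma F_deriv:
  assumes "is_F_derivative X \<F> f g"
  shows "is_F_derivative X \<F> f (F_deriv X \<F> f)" "z \<in> X \<Longrightarrow> F_deriv X \<F> f z = g z"
proof -
  have r: "is_F_derivative X \<F> f (restrict g X)"
    using assms is_F_derivative_cong[of f f "restrict g X" g] by simp
  have "F_deriv X \<F> f = restrict g X"
    unfolding F_deriv_def
  proof (rule the_equality)
    fix h assume h: "h \<in> extensional X \<and> is_F_derivative X \<F> f h"
    show "h = restrict g X"
      by (rule extensionalityI[of _ X]) (use h is_F_derivative_unique[OF _ r] in auto)
  qed (use r in simp)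
  with r show "is_F_derivative X \<F> f (F_deriv X \<F> f)" "z \<in> X \<Longrightarrow> F_deriv X \<F> f z = g z" by auto
qed

lemma F_nth_deriv_Suc: "F_nth_deriv X \<F> (Suc k) f = F_deriv X \<F> (F_nth_deriv X \<F> k f)"
  by (simp add: F_nth_deriv_def)

lemma F_nth_deriv_0: "F_nth_deriv X \<F> 0 f = f"
  by (simp add: F_nth_deriv_def)

lemma F_diff_Suc:
  "f \<in> F_diff X \<F> (Suc n) \<longleftrightarrow> f \<in> F_differentiable X \<F> \<and> F_deriv X \<F> f \<in> F_diff X \<F> n"
proof (cases n)
  case 0
  have "continuous_on X (F_deriv X \<F> f)" if "f \<in> F_differentiable X \<F>"
    using that F_deriv(1) by (auto simp: F_differentiable_def is_F_derivative_def)
  with 0 show ?thesis by auto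
qed simp

lemma F_diff_iff:
  "f \<in> F_diff X \<F> n \<longleftrightarrow>
     continuous_on X f \<and> (\<forall>k<n. F_nth_deriv X \<F> k f \<in> F_differentiable X \<F>)"
proof (induction n arbitrary: f)
  case (Suc n)
  have "F_nth_deriv X \<F> (Suc k) f = F_nth_deriv X \<F> k (F_deriv X \<F> f)" for k
    by (simp add: F_nth_deriv_def funpow_swap1)
  moreover have "continuous_on X f \<and> continuous_on X (F_deriv X \<F> f)"
    if "f \<in> F_differentiable X \<F>"
    using that F_deriv(1) by (auto simp: F_differentiable_def is_F_derivative_def)
  ultimately show ?case
    unfolding F_diff_Suc Suc.IH by (auto simp: less_Suc_eq_0_disj F_nth_deriv_0)
qed simp

lemma is_F_derivative_nth:
  assumes "f \<in> F_diff X \<F> n" "k < n"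
  shows "is_F_derivative X \<F> (F_nth_deriv X \<F> k f) (F_nth_deriv X \<F> (Suc k) f)"
  using assms F_deriv(1) unfolding F_diff_iff F_nth_deriv_Suc F_differentiable_def by blast

lemma is_F_derivative_const: "is_F_derivative X \<F> (\<lambda>_. c) (\<lambda>_. 0)"
  unfolding is_F_derivative_iff_along
proof (intro conjI ballI)
  fix \<gamma> assume "\<gamma> \<in> \<F>"
  then show "derivative_along \<gamma> (\<lambda>t. c) (\<lambda>t. 0)"
    using arclen_mono[OF rectifiable] unfolding derivative_along_def
    by (intro allI impI exI[of _ 1]) auto
qed simp_all

lemma is_F_derivative_add:
  assumes "is_F_derivative X \<F> f f'" "is_F_derivative X \<F> g g'"
  shows "is_F_derivative X \<F> (\<lambda>z. f z + g z) (\<lambda>z. f' z + g' z)"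
  using assms unfolding is_F_derivative_iff_along
  by (auto intro: continuous_on_add derivative_along_add)

lemma is_F_derivative_mult:
  assumes "is_F_derivative X \<F> f f'" "is_F_derivative X \<F> g g'"
  shows "is_F_derivative X \<F> (\<lambda>z. f z * g z) (\<lambda>z. f' z * g z + f z * g' z)"
  using assms unfolding is_F_derivative_iff_along
  by (auto intro!: continuous_on_add continuous_on_mult derivative_along_mult
      continuous_on_path rectifiable)

lemma is_F_derivative_cmult:
  assumes "is_F_derivative X \<F> f f'"
  shows "is_F_derivative X \<F> (\<lambda>z. c * f z) (\<lambda>z. c * f' z)"
  using is_F_derivative_mult[OF is_F_derivative_const[of c] assms] by simp

lemma is_F_derivative_sum:
  assumes "\<And>i. i \<in> I \<Longrightarrow> is_F_derivative X \<F> (f i) (f' i)"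
  shows "is_F_derivative X \<F> (\<lambda>z. \<Sum>i\<in>I. f i z) (\<lambda>z. \<Sum>i\<in>I. f' i z)"
  using assms
  by (induction I rule: infinite_finite_induct)
    (auto intro: is_F_derivative_const is_F_derivative_add)

end

text \<open>
  Compatibility is used for the local condition on \<open>f\<close> along \<open>\<psi> = \<phi> \<circ> \<gamma>\<close>, either directly if \<open>\<psi>\<close> is constant or
  through its path length parametrisation.  The latter makes sense as \<open>\<psi>\<close> is rectifiable, being
  Lipschitz with respect to the arc length of \<open>\<gamma>\<close>.
\<close>

lemma is_F_derivative_comp:
  assumes "effective_collection X \<F>" "effective_collection Y \<G>"
    and comp: "compatible X \<F> Y \<G> \<phi>"
    and \<phi>: "is_F_derivative X \<F> \<phi> \<phi>'" and f: "f \<in> F_differentiable Y \<G>"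
  shows "is_F_derivative X \<F> (\<lambda>z. f (\<phi> z)) (\<lambda>z. F_deriv Y \<G> f (\<phi> z) * \<phi>' z)"
proof -
  interpret X: effective_collection X \<F> by fact
  interpret Y: effective_collection Y \<G> by fact
  let ?f' = "F_deriv Y \<G> f"
  have \<phi>XY: "\<phi> ` X \<subseteq> Y" using comp by (simp add: compatible_def)
  have contf: "continuous_on Y f" "continuous_on Y ?f'"
    using f Y.F_deriv(1) by (auto simp: F_differentiable_def is_F_derivative_def)
  have cont\<phi>: "continuous_on X \<phi>" "continuous_on X \<phi>'"
    using \<phi> by (auto simp: is_F_derivative_def)
  have cont: "continuous_on X (\<lambda>z. f (\<phi> z))" "continuous_on X (\<lambda>z. ?f' (\<phi> z))"
    using contf cont\<phi> \<phi>XY by (auto intro: continuous_on_compose2)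
  show ?thesis
    unfolding X.is_F_derivative_iff_along
  proof (intro conjI ballI)
    show "continuous_on X (\<lambda>z. ?f' (\<phi> z) * \<phi>' z)" by (intro continuous_on_mult cont cont\<phi>)
    fix \<gamma> assume \<gamma>: "\<gamma> \<in> \<F>"
    define \<psi> where "\<psi> = comp_path \<phi> \<gamma>"
    note rect\<gamma> = X.rectifiable[OF \<gamma>]
    have same: "lo \<psi> = lo \<gamma>" "hi \<psi> = hi \<gamma>" "dom \<psi> = dom \<gamma>"
      by (simp_all add: \<psi>_def comp_path_def dom_def)
    have \<psi>: "pfun \<psi> t = \<phi> (pfun \<gamma> t)" if "t \<in> dom \<gamma>" for t
      using that by (simp add: \<psi>_def comp_path_def compose_def)
    have "derivative_along \<gamma> (\<lambda>t. \<phi> (pfun \<gamma> t)) (\<lambda>t. \<phi>' (pfun \<gamma> t))"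
      using \<phi> \<gamma> by (simp add: X.is_F_derivative_iff_along)
    then have along\<psi>: "derivative_along \<gamma> (pfun \<psi>) (\<lambda>t. \<phi>' (pfun \<gamma> t))"
      using \<psi> by (subst derivative_along_cong) auto
    have cont\<phi>': "continuous_on (dom \<gamma>) (\<lambda>t. \<phi>' (pfun \<gamma> t))"
      by (rule X.continuous_on_path[OF \<gamma> cont\<phi>(2)])
    have path\<psi>: "is_path \<psi>"
    proof -
      have "continuous_on (dom \<gamma>) (pfun \<psi>)"
        using X.continuous_on_path[OF \<gamma> cont\<phi>(1)] \<psi> by (simp cong: continuous_on_cong)
      moreover have "pfun \<psi> \<in> extensional (dom \<gamma>)" by (simp add: \<psi>_def comp_path_def)
      ultimately show ?thesis using X.path_in_X(1)[OF \<gamma>] by (simp add: is_path_def same)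
    qed
    obtain M where "\<And>c d. lo \<gamma> \<le> c \<Longrightarrow> c \<le> d \<Longrightarrow> d \<le> hi \<gamma> \<Longrightarrow>
        norm (pfun \<psi> d - pfun \<psi> c) \<le> M * (arclen \<gamma> d - arclen \<gamma> c)"
      using derivative_along_lipschitz[OF rect\<gamma> along\<psi> cont\<phi>'] by blast
    then have rect\<psi>: "rectifiable \<psi>"
      by (intro rectifiable_if_dominated[OF path\<psi>, where W = "\<lambda>t. M * arclen \<gamma> t"])
        (simp add: same right_diff_distrib)
    have "derivative_along \<psi> (\<lambda>t. f (pfun \<psi> t)) (\<lambda>t. ?f' (pfun \<psi> t))"
    proof (cases "constant_path \<psi>")
      case True
      then show ?thesis by (rule derivative_along_constant_path[OF rect\<psi>])
    next
      case False
      let ?\<eta> = "path_length_param \<psi>"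
      have \<eta>: "path_in Y ?\<eta>" "admissible ?\<eta>" "is_path_derivative Y ?\<eta> f ?f'"
        using comp \<gamma> False f by (auto simp: compatible_def max_collection_def \<psi>_def)
      have "derivative_along ?\<eta> (\<lambda>u. f (pfun ?\<eta> u)) (\<lambda>u. ?f' (pfun ?\<eta> u))"
      proof (rule integral_imp_derivative_along)
        show "continuous_on (trace ?\<eta>) ?f'"
          using contf(2) \<eta>(1) by (auto simp: path_in_def intro: continuous_on_subset)
      qed (use \<eta>(2,3) in \<open>auto simp: admissible_def is_path_derivative_def\<close>)
      then show ?thesis by (rule derivative_along_from_path_length_param[OF rect\<psi> False])
    qed
    moreover have "derivative_along \<psi> (\<lambda>t. f (pfun \<psi> t)) (\<lambda>t. ?f' (pfun \<psi> t)) \<longleftrightarrow>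
        derivative_along \<psi> (\<lambda>t. f (\<phi> (pfun \<gamma> t))) (\<lambda>t. ?f' (\<phi> (pfun \<gamma> t)))"
      by (rule derivative_along_cong) (simp_all add: same \<psi>)
    ultimately show "derivative_along \<gamma> (\<lambda>t. f (\<phi> (pfun \<gamma> t)))
        (\<lambda>t. ?f' (\<phi> (pfun \<gamma> t)) * \<phi>' (pfun \<gamma> t))"
      by (intro derivative_along_chain[OF rect\<gamma> rect\<psi> same(1,2) along\<psi> cont\<phi>']
          X.continuous_on_path[OF \<gamma> cont(2)]) simp
  qed (fact cont)
qed

section \<open>Powers of formal power series and exponent sums\<close>

text \<open>
  For the index set \<open>{1..k}\<close> these are the exponents in the theorem; general index sets allow induction on
  the set.
\<close>

definition weighted_exponents :: "nat set \<Rightarrow> nat \<Rightarrow> nat \<Rightarrow> (nat \<Rightarrow> nat) set" where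
  "weighted_exponents A i k =
     {a \<in> A \<rightarrow>\<^sub>E UNIV. (\<Sum>j\<in>A. a j) = i \<and> (\<Sum>j\<in>A. j * a j) = k}"

lemma finite_weighted_exponents:
  assumes "finite A"
  shows "finite (weighted_exponents A i k)"
proof (rule finite_subset)
  show "weighted_exponents A i k \<subseteq> A \<rightarrow>\<^sub>E {..i}"
  proof
    fix a assume a: "a \<in> weighted_exponents A i k"
    have "a j \<le> i" if "j \<in> A" for j
      using member_le_sum[OF that, of a] a assms by (simp add: weighted_exponents_def)
    with a show "a \<in> A \<rightarrow>\<^sub>E {..i}"
      unfolding weighted_exponents_def PiE_iff by blast
  qed
qed (use assms in \<open>simp add: finite_PiE\<close>)

lemma fps_nth_binomial_monom:
  fixes s :: "'a :: field_char_0 fps"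
  shows "fps_nth ((fps_const c * fps_X ^ m + s) ^ i) k / fact i =
    (\<Sum>b\<in>{b. b \<le> i \<and> m * b \<le> k}. c ^ b / fact b * (fps_nth (s ^ (i - b)) (k - m * b) / fact (i - b)))"
proof -
  have coeff: "fps_nth (of_nat (i choose b) * (fps_const c * fps_X ^ m) ^ b * s ^ (i - b)) k / fact i =
      (if m * b \<le> k then c ^ b / fact b * (fps_nth (s ^ (i - b)) (k - m * b) / fact (i - b)) else 0)"
    if "b \<le> i" for b
  proof -
    have eq: "of_nat (i choose b) * (fps_const c * fps_X ^ m) ^ b * s ^ (i - b) =
        fps_const (of_nat (i choose b) * c ^ b) * (fps_X ^ (m * b) * s ^ (i - b))"
      by (simp only: power_mult_distrib fps_const_power power_mult fps_of_nat[symmetric]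
        fps_const_mult[symmetric] mult.assoc)
    have nth: "fps_nth (of_nat (i choose b) * (fps_const c * fps_X ^ m) ^ b * s ^ (i - b)) k =
        of_nat (i choose b) * c ^ b * (if k < m * b then 0 else fps_nth (s ^ (i - b)) (k - m * b))"
      by (simp only: eq fps_mult_left_const_nth fps_X_power_mult_nth)
    show ?thesis
      unfolding nth binomial_fact[OF that, where ?'a = 'a] by (cases "k < m * b") simp_all
  qed
  have "fps_nth ((fps_const c * fps_X ^ m + s) ^ i) k / fact i =
      (\<Sum>b\<le>i. fps_nth (of_nat (i choose b) * (fps_const c * fps_X ^ m) ^ b * s ^ (i - b)) k / fact i)"
    by (simp add: binomial_ring fps_sum_nth sum_divide_distrib)
  also have "\<dots> = (\<Sum>b\<le>i. if m * b \<le> k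
      then c ^ b / fact b * (fps_nth (s ^ (i - b)) (k - m * b) / fact (i - b)) else 0)"
    by (intro sum.cong refl coeff) simp
  also have "\<dots> = (\<Sum>b\<in>{b. b \<le> i \<and> m * b \<le> k}.
      c ^ b / fact b * (fps_nth (s ^ (i - b)) (k - m * b) / fact (i - b)))"
    by (rule sum.mono_neutral_cong_right) auto
  finally show ?thesis .
qed

text \<open>
  The multinomial theorem, read off at one coefficient.  A new index \<open>m\<close> splits the exponents according
  to the value \<open>b\<close> at \<open>m\<close>, which corresponds to the binomial expansion of the power.
\<close>

lemma fps_nth_multinomial:
  fixes c :: "nat \<Rightarrow> 'a :: field_char_0"
  assumes "finite A"
  shows "fps_nth ((\<Sum>j\<in>A. fps_const (c j) * fps_X ^ j) ^ i) k / fact i =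
    (\<Sum>a\<in>weighted_exponents A i k. \<Prod>j\<in>A. c j ^ a j / fact (a j))"
  using assms
proof (induction A arbitrary: i k rule: finite_induct)
  case empty
  have "weighted_exponents {} i k = (if i = 0 \<and> k = 0 then {\<lambda>_. undefined} else {})"
    by (auto simp: weighted_exponents_def)
  then show ?case by (cases i) auto
next
  case (insert m A)
  let ?w = "weighted_exponents"
  let ?S = "SIGMA b:{b. b \<le> i \<and> m * b \<le> k}. ?w A (i - b) (k - m * b)"
  have fin: "finite {b. b \<le> i \<and> m * b \<le> k}" by (rule finite_subset[of _ "{..i}"]) auto
  have "fps_nth ((\<Sum>j\<in>insert m A. fps_const (c j) * fps_X ^ j) ^ i) k / fact i =
      (\<Sum>b\<in>{b. b \<le> i \<and> m * b \<le> k}. c m ^ b / fact b *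
        (\<Sum>a\<in>?w A (i - b) (k - m * b). \<Prod>j\<in>A. c j ^ a j / fact (a j)))"
    using insert by (simp add: fps_nth_binomial_monom)
  also have "\<dots> = (\<Sum>(b, a)\<in>?S. c m ^ b / fact b * (\<Prod>j\<in>A. c j ^ a j / fact (a j)))"
    unfolding sum_distrib_left
    by (rule sum.Sigma) (use fin finite_weighted_exponents[OF insert.hyps(1)] in auto)
  also have "\<dots> = (\<Sum>a\<in>?w (insert m A) i k. \<Prod>j\<in>insert m A. c j ^ a j / fact (a j))"
  proof (rule sum.reindex_bij_witness[where i = "\<lambda>a. (a m, a(m := undefined))"
        and j = "\<lambda>(b, a). a(m := b)"])
    fix p assume p: "p \<in> ?S"
    obtain b a where ba: "p = (b, a)" "b \<le> i" "m * b \<le> k" "a \<in> ?w A (i - b) (k - m * b)"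
      using p by auto
    have undef: "a m = undefined"
      using ba(4) insert.hyps(2) by (auto simp: weighted_exponents_def PiE_def extensional_def)
    then show "((case p of (b, a) \<Rightarrow> a(m := b)) m, (case p of (b, a) \<Rightarrow> a(m := b))(m := undefined)) = p"
      using ba(1) by auto
    have upd: "(\<Sum>j\<in>A. h j ((a(m := b)) j)) = (\<Sum>j\<in>A. h j (a j))" for h :: "nat \<Rightarrow> nat \<Rightarrow> nat"
      using insert.hyps(2) by (intro sum.cong) auto
    show "(case p of (b, a) \<Rightarrow> a(m := b)) \<in> ?w (insert m A) i k"
      using ba insert.hyps upd[of "\<lambda>_ x. x"] upd[of "\<lambda>j x. j * x"]
      by (auto simp: weighted_exponents_def PiE_def extensional_def)
    have "(\<Prod>j\<in>A. c j ^ (a(m := b)) j / fact ((a(m := b)) j)) = (\<Prod>j\<in>A. c j ^ a j / fact (a j))"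
      using insert.hyps(2) by (intro prod.cong) auto
    then show "(\<Prod>j\<in>insert m A. c j ^ (case p of (b, a) \<Rightarrow> a(m := b)) j /
          fact ((case p of (b, a) \<Rightarrow> a(m := b)) j)) =
        (case p of (b, a) \<Rightarrow> c m ^ b / fact b * (\<Prod>j\<in>A. c j ^ a j / fact (a j)))"
      using ba(1) insert.hyps by simp
  next
    fix a assume a: "a \<in> ?w (insert m A) i k"
    show "(case (a m, a(m := undefined)) of (b, a) \<Rightarrow> a(m := b)) = a" by simp
    have upd: "(\<Sum>j\<in>A. h j ((a(m := undefined)) j)) = (\<Sum>j\<in>A. h j (a j))"
      for h :: "nat \<Rightarrow> nat \<Rightarrow> nat"
      using insert.hyps(2) by (intro sum.cong) auto
    show "(a m, a(m := undefined)) \<in> ?S"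
      using a insert.hyps upd[of "\<lambda>_ x. x"] upd[of "\<lambda>j x. j * x"]
      by (auto simp: weighted_exponents_def PiE_def extensional_def)
  qed
  finally show ?case .
qed

lemma fps_power_nth_cong:
  fixes P Q :: "'a :: comm_ring_1 fps"
  assumes "\<And>l. l \<le> k \<Longrightarrow> fps_nth P l = fps_nth Q l"
  shows "l \<le> k \<Longrightarrow> fps_nth (P ^ i) l = fps_nth (Q ^ i) l"
  by (induction i arbitrary: l) (auto simp: fps_mult_nth assms intro!: sum.cong)

text \<open>
  The coefficient of order \<open>k\<close> of a power only depends on the coefficients up to order \<open>k\<close>, so the
  series can be replaced by a polynomial.
\<close>

lemma fps_power_nth_multinomial:
  fixes P :: "'a :: field_char_0 fps"
  assumes "fps_nth P 0 = 0"
  shows "fps_nth (P ^ i) k / fact i =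
    (\<Sum>a\<in>weighted_exponents {1..k} i k. \<Prod>j=1..k. fps_nth P j ^ a j / fact (a j))"
proof -
  have "fps_nth P l = fps_nth (\<Sum>j=1..k. fps_const (fps_nth P j) * fps_X ^ j) l" if "l \<le> k" for l
    using that assms by (cases "l = 0") (auto simp: fps_sum_nth fps_X_power_nth if_distrib sum.delta' cong: if_cong)
  from fps_power_nth_cong[of k P "\<Sum>j=1..k. fps_const (fps_nth P j) * fps_X ^ j" k i, OF this]
  have "fps_nth (P ^ i) k = fps_nth ((\<Sum>j=1..k. fps_const (fps_nth P j) * fps_X ^ j) ^ i) k" by simp
  then show ?thesis by (simp only: fps_nth_multinomial[OF finite_atLeastAtMost])
qed

text \<open>
  With \<open>c i\<close> in the role of \<open>f\<^bsup>[i]\<^esup> \<circ> \<phi>\<close>, the left-hand side is what the product and chain rules yield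
  for the derivative of the formula of order \<open>k\<close>.  Since \<open>i P\<^bsup>i-1\<^esup> P' = (P\<^sup>i)'\<close>, each
  term is a term of the formula of order \<open>k + 1\<close> plus a difference of consecutive values of \<open>r\<close>.
\<close>

lemma bell_recursion:
  fixes P :: "'a :: field_char_0 fps" and c :: "nat \<Rightarrow> 'a"
  assumes P0: "fps_nth P 0 = 0"
  defines "x \<equiv> fps_nth P 1"
  shows "fact k * (\<Sum>i\<le>k. (c (Suc i) * x * fps_nth (P ^ i) k +
      c i * fps_nth (of_nat i * P ^ (i - 1) * (fps_deriv P - fps_const x)) k) / fact i) =
    fact (Suc k) * (\<Sum>i\<le>Suc k. c i * fps_nth (P ^ i) (Suc k) / fact i)"
proof -
  define r where "r i = c i * x * (if i = 0 then 0 else fps_nth (P ^ (i - 1)) k / fact (i - 1))" for i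
  define q where "q i = of_nat (Suc k) * (c i * fps_nth (P ^ i) (Suc k) / fact i)" for i
  have term_eq: "(c (Suc i) * x * fps_nth (P ^ i) k +
      c i * fps_nth (of_nat i * P ^ (i - 1) * (fps_deriv P - fps_const x)) k) / fact i =
    r (Suc i) - r i + q i" for i
  proof -
    have "of_nat i * P ^ (i - 1) * (fps_deriv P - fps_const x) =
        fps_deriv (P ^ i) - fps_const (of_nat i * x) * P ^ (i - 1)"
      by (simp add: fps_deriv_power' algebra_simps fps_of_nat[symmetric] flip: fps_const_mult)
    then have nth: "fps_nth (of_nat i * P ^ (i - 1) * (fps_deriv P - fps_const x)) k =
        of_nat (Suc k) * fps_nth (P ^ i) (Suc k) - of_nat i * x * fps_nth (P ^ (i - 1)) k"
      by simp
    show ?thesis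
      unfolding nth r_def q_def
      by (cases i) (simp_all add: field_simps del: of_nat_Suc)
  qed
  have "(\<Sum>i\<le>k. (c (Suc i) * x * fps_nth (P ^ i) k +
      c i * fps_nth (of_nat i * P ^ (i - 1) * (fps_deriv P - fps_const x)) k) / fact i) =
    (\<Sum>i\<le>k. r (Suc i) - r i) + (\<Sum>i\<le>k. q i)"
    unfolding term_eq by (rule sum.distrib)
  also have "(\<Sum>i\<le>k. r (Suc i) - r i) = r (Suc k) - r 0"
    using sum_lessThan_telescope[of r "Suc k"] by (simp only: lessThan_Suc_atMost)
  \<comment> \<open>Both sides are \<open>c (k + 1) x\<^bsup>k+1\<^esup> / k!\<close>, since \<open>x\<^sup>k\<close> is the lowest coefficient of \<open>P\<^sup>k\<close>.\<close>
  also have "r (Suc k) - r 0 = q (Suc k)"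
    unfolding r_def q_def
    by (simp add: startsby_zero_power_nth_same[OF P0] x_def field_simps del: of_nat_Suc power_Suc)
       (simp add: power_Suc)
  also have "q (Suc k) + (\<Sum>i\<le>k. q i) = (\<Sum>i\<le>Suc k. q i)" by simp
  also have "fact k * \<dots> = fact (Suc k) * (\<Sum>i\<le>Suc k. c i * fps_nth (P ^ i) (Suc k) / fact i)"
    unfolding q_def sum_distrib_left[symmetric] by (simp add: mult_ac)
  finally show ?thesis .
qed

section \<open>Higher derivatives of a composition\<close>

context effective_collection
begin

text \<open>
  Coefficientwise differentiation on \<open>X\<close>.  Only finitely many coefficients are considered
  because the coefficients of the series below are derivatives of a function that
  need not be differentiable infinitely often.
\<close>

definition fps_derivative_upto ::
    "nat \<Rightarrow> (complex \<Rightarrow> complex fps) \<Rightarrow> (complex \<Rightarrow> complex fps) \<Rightarrow> bool" where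
  "fps_derivative_upto m A A' \<longleftrightarrow>
     (\<forall>k\<le>m. is_F_derivative X \<F> (\<lambda>z. fps_nth (A z) k) (\<lambda>z. fps_nth (A' z) k))"

lemma fps_derivative_upto_mult:
  assumes "fps_derivative_upto m A A'" "fps_derivative_upto m B B'"
  shows "fps_derivative_upto m (\<lambda>z. A z * B z) (\<lambda>z. A' z * B z + A z * B' z)"
  using assms unfolding fps_derivative_upto_def
  by (auto simp: fps_mult_nth sum.distrib[symmetric]
      intro!: is_F_derivative_sum is_F_derivative_mult)

lemma fps_derivative_upto_power:
  assumes "fps_derivative_upto m A A'"
  shows "fps_derivative_upto m (\<lambda>z. A z ^ i) (\<lambda>z. of_nat i * A z ^ (i - 1) * A' z)"
proof (induction i)
  case 0
  then show ?case by (simp add: fps_derivative_upto_def is_F_derivative_const)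
next
  case (Suc i)
  have "A' z * A z ^ i + A z * (of_nat i * A z ^ (i - 1) * A' z) =
      of_nat (Suc i) * A z ^ (Suc i - 1) * A' z" for z
    by (cases i) (simp_all add: algebra_simps)
  with fps_derivative_upto_mult[OF assms Suc.IH] show ?case by simp
qed

end

text \<open>
  The formal Taylor expansion of \<open>\<phi> (z + t) - \<phi> z\<close> in \<open>t\<close>.
\<close>

definition taylor_increment :: "complex set \<Rightarrow> cpath set \<Rightarrow> (complex \<Rightarrow> complex) \<Rightarrow> complex \<Rightarrow> complex fps" where
  "taylor_increment X \<F> \<phi> z = Abs_fps (\<lambda>j. if j = 0 then 0 else F_nth_deriv X \<F> j \<phi> z / fact j)"

text \<open>
  This is \<open>k!\<close> times the coefficient of \<open>t\<^sup>k\<close> in the formal expansion of \<open>f (\<phi> (z + t))\<close>: the Taylor series of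
  \<open>f\<close> at \<open>\<phi> z\<close> is evaluated at the increment of \<open>\<phi>\<close>.
\<close>

definition composite_deriv :: "complex set \<Rightarrow> cpath set \<Rightarrow> complex set \<Rightarrow> cpath set \<Rightarrow>
    (complex \<Rightarrow> complex) \<Rightarrow> (complex \<Rightarrow> complex) \<Rightarrow> nat \<Rightarrow> complex \<Rightarrow> complex" where
  "composite_deriv X \<F> Y \<G> f \<phi> k z = fact k *
     (\<Sum>i\<le>k. F_nth_deriv Y \<G> i f (\<phi> z) * fps_nth (taylor_increment X \<F> \<phi> z ^ i) k / fact i)"

text \<open>
  The derivative of \<open>\<phi>\<^bsup>[j]\<^esup> / j!\<close> is the coefficient of \<open>t\<^sup>j\<close> in the formal derivative of the series.
  The constant coefficient of the formal derivative, \<open>\<phi>\<^bsup>[1]\<^esup>\<close>, has to be removed since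
  the series has constant coefficient 0.
\<close>

lemma (in effective_collection) fps_derivative_taylor_increment:
  assumes "\<phi> \<in> F_diff X \<F> n" "k < n"
  shows "fps_derivative_upto k (taylor_increment X \<F> \<phi>)
    (\<lambda>z. fps_deriv (taylor_increment X \<F> \<phi> z) - fps_const (fps_nth (taylor_increment X \<F> \<phi> z) 1))"
  unfolding fps_derivative_upto_def
proof (intro allI impI)
  fix l assume "l \<le> k"
  show "is_F_derivative X \<F> (\<lambda>z. fps_nth (taylor_increment X \<F> \<phi> z) l)
      (\<lambda>z. fps_nth (fps_deriv (taylor_increment X \<F> \<phi> z)
        - fps_const (fps_nth (taylor_increment X \<F> \<phi> z) 1)) l)"
  proof (cases "l = 0")
    case True
    then show ?thesis by (simp add: taylor_increment_def is_F_derivative_const)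
  next
    case False
    have "is_F_derivative X \<F> (\<lambda>z. 1 / fact l * F_nth_deriv X \<F> l \<phi> z)
        (\<lambda>z. 1 / fact l * F_nth_deriv X \<F> (Suc l) \<phi> z)"
      using assms \<open>l \<le> k\<close> by (intro is_F_derivative_cmult is_F_derivative_nth) auto
    with False show ?thesis by (simp add: taylor_increment_def divide_simps del: of_nat_Suc)
  qed
qed

lemma composite_deriv_step:
  assumes X: "effective_collection X \<F>" and Y: "effective_collection Y \<G>"
    and comp: "compatible X \<F> Y \<G> \<phi>"
    and \<phi>: "\<phi> \<in> F_diff X \<F> n" and f: "f \<in> F_diff Y \<G> n" and k: "k < n"
  shows "is_F_derivative X \<F> (composite_deriv X \<F> Y \<G> f \<phi> k) (composite_deriv X \<F> Y \<G> f \<phi> (Suc k))"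
proof -
  interpret X: effective_collection X \<F> by fact
  interpret Y: effective_collection Y \<G> by fact
  let ?P = "taylor_increment X \<F> \<phi>"
  let ?c = "\<lambda>z i. F_nth_deriv Y \<G> i f (\<phi> z)"
  have "is_F_derivative X \<F> (F_nth_deriv X \<F> 0 \<phi>) (F_nth_deriv X \<F> (Suc 0) \<phi>)"
    using X.is_F_derivative_nth[OF \<phi>, of 0] k by simp
  moreover have "F_nth_deriv X \<F> (Suc 0) \<phi> = (\<lambda>z. fps_nth (?P z) 1)"
    by (simp add: taylor_increment_def)
  ultimately have \<phi>': "is_F_derivative X \<F> \<phi> (\<lambda>z. fps_nth (?P z) 1)"
    by (simp add: X.F_nth_deriv_0)
  have outer: "is_F_derivative X \<F> (\<lambda>z. ?c z i) (\<lambda>z. ?c z (Suc i) * fps_nth (?P z) 1)" if "i \<le> k" for i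
  proof -
    have "F_nth_deriv Y \<G> i f \<in> F_differentiable Y \<G>" using f that k by (simp add: Y.F_diff_iff)
    from is_F_derivative_comp[OF X Y comp \<phi>' this] show ?thesis by (simp add: Y.F_nth_deriv_Suc)
  qed
  have inner: "is_F_derivative X \<F> (\<lambda>z. fps_nth (?P z ^ i) k)
      (\<lambda>z. fps_nth (of_nat i * ?P z ^ (i - 1) * (fps_deriv (?P z) - fps_const (fps_nth (?P z) 1))) k)"
    for i
    using X.fps_derivative_upto_power[OF X.fps_derivative_taylor_increment[OF \<phi> k], of i]
    unfolding X.fps_derivative_upto_def by blast
  have "is_F_derivative X \<F> (\<lambda>z. fact k * (\<Sum>i\<le>k. 1 / fact i * (?c z i * fps_nth (?P z ^ i) k)))
      (\<lambda>z. fact k * (\<Sum>i\<le>k. 1 / fact i * (?c z (Suc i) * fps_nth (?P z) 1 * fps_nth (?P z ^ i) k +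
        ?c z i * fps_nth (of_nat i * ?P z ^ (i - 1) *
          (fps_deriv (?P z) - fps_const (fps_nth (?P z) 1))) k)))"
    by (intro X.is_F_derivative_cmult X.is_F_derivative_sum X.is_F_derivative_mult outer inner) simp
  moreover have "(\<lambda>z. fact k * (\<Sum>i\<le>k. 1 / fact i * (?c z i * fps_nth (?P z ^ i) k))) =
      composite_deriv X \<F> Y \<G> f \<phi> k"
    by (simp add: composite_deriv_def fun_eq_iff)
  moreover have "(\<lambda>z. fact k * (\<Sum>i\<le>k. 1 / fact i * (?c z (Suc i) * fps_nth (?P z) 1 * fps_nth (?P z ^ i) k +
        ?c z i * fps_nth (of_nat i * ?P z ^ (i - 1) *
          (fps_deriv (?P z) - fps_const (fps_nth (?P z) 1))) k))) =
      composite_deriv X \<F> Y \<G> f \<phi> (Suc k)"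
  proof
    fix z
    have P0: "fps_nth (?P z) 0 = 0" by (simp add: taylor_increment_def)
    show "fact k * (\<Sum>i\<le>k. 1 / fact i * (?c z (Suc i) * fps_nth (?P z) 1 * fps_nth (?P z ^ i) k +
        ?c z i * fps_nth (of_nat i * ?P z ^ (i - 1) *
          (fps_deriv (?P z) - fps_const (fps_nth (?P z) 1))) k)) =
      composite_deriv X \<F> Y \<G> f \<phi> (Suc k) z"
      unfolding composite_deriv_def bell_recursion[OF P0, symmetric]
      by (intro arg_cong[where f = "\<lambda>x. fact k * x"] sum.cong refl) (simp only: times_divide_eq_left mult_1_left)
  qed
  ultimately show ?thesis by simp
qed

lemma composite_deriv_eq_faa_di_bruno:
  "composite_deriv X \<F> Y \<G> f \<phi> k z =
    (\<Sum>i=0..k. (F_nth_deriv Y \<G> i f \<circ> \<phi>) z *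
      (\<Sum>a\<in>faa_di_bruno_indices k i.
         fact k / (\<Prod>j=1..k. fact (a j)) *
         (\<Prod>j=1..k. (F_nth_deriv X \<F> j \<phi> z / fact j) ^ a j)))"
proof -
  let ?P = "taylor_increment X \<F> \<phi> z"
  have P0: "fps_nth ?P 0 = 0" by (simp add: taylor_increment_def)
  have eq: "fact k * (fps_nth (?P ^ i) k / fact i) = (\<Sum>a\<in>faa_di_bruno_indices k i.
         fact k / (\<Prod>j=1..k. fact (a j)) *
         (\<Prod>j=1..k. (F_nth_deriv X \<F> j \<phi> z / fact j) ^ a j))" for i
  proof -
    have "faa_di_bruno_indices k i = weighted_exponents {1..k} i k"
      by (simp add: faa_di_bruno_indices_def weighted_exponents_def)
    moreover have "(\<Prod>j=1..k. fps_nth ?P j ^ a j / fact (a j)) =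
        (\<Prod>j=1..k. (F_nth_deriv X \<F> j \<phi> z / fact j) ^ a j) / (\<Prod>j=1..k. fact (a j))" for a
      by (simp add: prod_dividef taylor_increment_def)
    ultimately show ?thesis
      unfolding fps_power_nth_multinomial[OF P0] sum_distrib_left by (intro sum.cong) simp_all
  qed
  show ?thesis
    unfolding composite_deriv_def eq[symmetric] atLeast0AtMost
    by (subst sum_distrib_left) (simp add: mult_ac)
qed

theorem corollary4p5:
  fixes X Y :: "complex set" and \<F> \<G> :: "cpath set" and n :: nat
    and \<phi> :: "complex \<Rightarrow> complex"
  assumes "compact_plane_set X" and "semi_rectifiable X"
    and "compact_plane_set Y" and "semi_rectifiable Y"
    and "effective X \<F>" and "effective Y \<G>"
    and "n \<ge> 1"
    and "\<phi> \<in> F_diff X \<F> n" and "\<phi> ` X \<subseteq> Y"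
    and "compatible X \<F> Y \<G> \<phi>"
  shows "\<forall>f \<in> F_diff Y \<G> n.
    f \<circ> \<phi> \<in> F_diff X \<F> n \<and>
    (\<forall>k\<in>{1..n}. \<forall>z\<in>X.
      F_nth_deriv X \<F> k (f \<circ> \<phi>) z =
        (\<Sum>i=0..k. (F_nth_deriv Y \<G> i f \<circ> \<phi>) z *
          (\<Sum>a\<in>faa_di_bruno_indices k i.
             fact k / (\<Prod>j=1..k. fact (a j)) *
             (\<Prod>j=1..k. (F_nth_deriv X \<F> j \<phi> z / fact j) ^ a j))))"
proof
  fix f assume f: "f \<in> F_diff Y \<G> n"
  interpret X: effective_collection X \<F> using assms by unfold_locales
  interpret Y: effective_collection Y \<G> using assms by unfold_locales
  let ?T = "composite_deriv X \<F> Y \<G> f \<phi>"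
  note step = composite_deriv_step[OF X.effective_collection_axioms Y.effective_collection_axioms
      \<open>compatible X \<F> Y \<G> \<phi>\<close> \<open>\<phi> \<in> F_diff X \<F> n\<close> f]
  have T0: "?T 0 z = (f \<circ> \<phi>) z" for z by (simp add: composite_deriv_def Y.F_nth_deriv_0)
  have nth_step: "is_F_derivative X \<F> (F_nth_deriv X \<F> k (f \<circ> \<phi>)) (?T (Suc k))"
    if "k < n" "\<And>z. z \<in> X \<Longrightarrow> F_nth_deriv X \<F> k (f \<circ> \<phi>) z = ?T k z" for k
    using step[OF that(1)]
      X.is_F_derivative_cong[of "F_nth_deriv X \<F> k (f \<circ> \<phi>)" "?T k", OF that(2) refl] by simp
  have nth_eq: "k \<le> n \<Longrightarrow> z \<in> X \<Longrightarrow> F_nth_deriv X \<F> k (f \<circ> \<phi>) z = ?T k z" for k z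
  proof (induction k arbitrary: z)
    case 0
    show ?case by (simp only: X.F_nth_deriv_0 T0)
  next
    case (Suc k)
    have "is_F_derivative X \<F> (F_nth_deriv X \<F> k (f \<circ> \<phi>)) (?T (Suc k))"
      by (rule nth_step[OF _ Suc.IH]) (use Suc.prems in simp_all)
    from X.F_deriv(2)[OF this \<open>z \<in> X\<close>] show ?case unfolding X.F_nth_deriv_Suc .
  qed
  have der: "is_F_derivative X \<F> (F_nth_deriv X \<F> k (f \<circ> \<phi>)) (?T (Suc k))" if "k < n" for k
    using that by (intro nth_step nth_eq) auto
  have "continuous_on X (f \<circ> \<phi>)"
    using der[of 0] \<open>n \<ge> 1\<close> by (simp add: X.F_nth_deriv_0 is_F_derivative_def)
  with der have "f \<circ> \<phi> \<in> F_diff X \<F> n"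
    unfolding X.F_diff_iff F_differentiable_def by blast
  then show "f \<circ> \<phi> \<in> F_diff X \<F> n \<and>
    (\<forall>k\<in>{1..n}. \<forall>z\<in>X.
      F_nth_deriv X \<F> k (f \<circ> \<phi>) z =
        (\<Sum>i=0..k. (F_nth_deriv Y \<G> i f \<circ> \<phi>) z *
          (\<Sum>a\<in>faa_di_bruno_indices k i.
             fact k / (\<Prod>j=1..k. fact (a j)) *
             (\<Prod>j=1..k. (F_nth_deriv X \<F> j \<phi> z / fact j) ^ a j))))"
    using nth_eq unfolding composite_deriv_eq_faa_di_bruno by (intro conjI ballI) auto
qed

end
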